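(* Let $n\ge 2$ be an integer. Let $\mathcal{U}$ be a von Neumann algebra with unit element $I$ and center $\mathrm{Z}(\mathcal{U})$, and let $E_1+E_2=I$, where $E_1$ and $E_2$ are two orthogonal central projections such that $\mathcal{U}E_1$ is of type $I_1$ and $\mathcal{U}E_2$ is a von Neumann algebra with no central summands of type $I_1$. Suppose that $P\in\mathcal{U}E_2$ is a core-free projection with central carrier $E_2$. Let $\mathcal{L},G_{\mathcal{L}}:\mathcal{U}\to\mathcal{U}$ be additive maps such that, for all $A_1,\ldots,A_n\in\mathcal{U}$ with $A_1A_2=P$, $$\mathcal{L}(p_n(A_1,\ldots,A_n))=\sum_{i=1}^{n}p_n(A_1,\ldots,A_{i-1},\mathcal{L}(A_i),A_{i+1},\ldots,A_n)$$ and $$\begin{aligned}G_{\mathcal{L}}(p_n(A_1,\ldots,A_n))&=p_n(G_{\mathcal{L}}(A_1),A_2,\ldots,A_n)+\sum_{i=2}^{n}p_n(A_1,\ldots,A_{i-1},\mathcal{L}(A_i),A_{i+1},\ldots,A_n)\\&=p_n(\mathcal{L}(A_1),A_2,\ldots,A_n)+p_n(A_1,G_{\mathcal{L}}(A_2),A_3,\ldots,A_n)\\&\quad+\sum_{i=3}^{n}p_n(A_1,\ldots,A_{i-1},\mathcal{L}(A_i),A_{i+1},\ldots,A_n).\end{aligned}$$ Then there exist $W\in\mathrm{Z}(\mathcal{U})$ and an additive map $\chi:\mathcal{U}\to\mathcal{U}$ such that $G_{\mathcal{L}}(A)=WA+\chi(A)$ for all $A\in\mathcal{U}$ and $$\chi(p_n(A_1,\ldots,A_n))=\sum_{i=1}^{n}p_n(A_1,\ldots,A_{i-1},\chi(A_i),A_{i+1},\ldots,A_n)$$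 for all $A_1,\ldots,A_n\in\mathcal{U}$ with $A_1A_2=P$.
   Context: A von Neumann algebra is a weakly closed, self-adjoint algebra of bounded operators on a complex Hilbert space containing the identity operator $I$. A projection is a self-adjoint idempotent. $[A,B]=AB-BA$; $p_1(A_1)=A_1$ and $p_n(A_1,\ldots,A_n)=[p_{n-1}(A_1,\ldots,A_{n-1}),A_n]$ for $n\ge 2$. The central carrier of $T\in\mathcal{U}$, denoted $\overline{T}$, is the smallest central projection $Q$ with $QT=T$. The core of a self-adjoint $S\in\mathcal{U}$ is $\underline{S}=\sup\{W\in\mathrm{Z}(\mathcal{U}):W=W^*,\ W\le S\}$. A projection $P$ is core-free if $\underline{P}=0$. A von Neumann algebra of type $I_1$ is an abelian one. Empty sums are zero. *)

theory Defs
  imports "HOL-Analysis.Analysis"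
begin

class scaleC =
  fixes scaleC :: "complex \<Rightarrow> 'a \<Rightarrow> 'a"  (infixr "*\<^sub>C" 75)

text \<open>The inner product is conjugate-linear in its first argument. Positive definiteness
  is contained in \<open>cinner_self\<close> together with the norm axioms of \<^class>\<open>banach\<close>.\<close>

class chilbert_space = banach + scaleC +
  fixes cinner :: "'a \<Rightarrow> 'a \<Rightarrow> complex"
  assumes scaleC_add_right: "c *\<^sub>C (x + y) = c *\<^sub>C x + c *\<^sub>C y"
    and scaleC_add_left: "(c + d) *\<^sub>C x = c *\<^sub>C x + d *\<^sub>C x"
    and scaleC_scaleC: "c *\<^sub>C d *\<^sub>C x = (c * d) *\<^sub>C x"
    and scaleC_of_real: "complex_of_real r *\<^sub>C x = r *\<^sub>R x"
    and cinner_commute: "cinner x y = cnj (cinner y x)"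
    and cinner_add_right: "cinner x (y + z) = cinner x y + cinner x z"
    and cinner_scaleC_right: "cinner x (c *\<^sub>C y) = c * cinner x y"
    and cinner_self: "cinner x x = complex_of_real ((norm x)\<^sup>2)"

lemma cinner_scaleC_left: "cinner (c *\<^sub>C (x::'a::chilbert_space)) y = cnj c * cinner x y"
  by (metis cinner_commute cinner_scaleC_right complex_cnj_mult)

lemma norm_scaleC: "norm (c *\<^sub>C (x::'a::chilbert_space)) = cmod c * norm x"
proof -
  have "complex_of_real ((norm (c *\<^sub>C x))\<^sup>2) = cnj c * (c * complex_of_real ((norm x)\<^sup>2))"
    by (simp only: cinner_self [symmetric] cinner_scaleC_left cinner_scaleC_right mult.left_commute)
  also have "\<dots> = complex_of_real ((cmod c * norm x)\<^sup>2)"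
    by (simp only: power_mult_distrib of_real_mult complex_norm_square [of c] mult_ac)
  finally have "(norm (c *\<^sub>C x))\<^sup>2 = (cmod c * norm x)\<^sup>2"
    by (simp only: of_real_eq_iff)
  then show ?thesis
    by (simp add: power2_eq_iff_nonneg)
qed

lemma bounded_linear_scaleC: "bounded_linear (\<lambda>x::'a::chilbert_space. c *\<^sub>C x)"
proof (rule bounded_linear_intro)
  fix x y :: 'a and r :: real
  show "c *\<^sub>C (x + y) = c *\<^sub>C x + c *\<^sub>C y"
    by (rule scaleC_add_right)
  show "c *\<^sub>C r *\<^sub>R x = r *\<^sub>R c *\<^sub>C x"
    by (metis scaleC_of_real scaleC_scaleC mult.commute)
  show "norm (c *\<^sub>C x) \<le> norm x * cmod c"
    by (simp add: norm_scaleC)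
qed

lemma scaleC_zero_right: "c *\<^sub>C (0::'a::chilbert_space) = 0"
  using scaleC_add_right [of c 0 0] by simp

lemma scaleC_minus_right: "c *\<^sub>C (- (x::'a::chilbert_space)) = - (c *\<^sub>C x)"
  using scaleC_add_right [of c x "- x"] by (simp add: scaleC_zero_right eq_neg_iff_add_eq_0 add.commute)

text \<open>The algebra of all bounded complex-linear operators on a Hilbert space. It is not
  made an instance of \<open>ring_1\<close> because \<open>0 = 1\<close> on the zero space.\<close>

typedef (overloaded) 'a bop =
  "{f :: 'a::chilbert_space \<Rightarrow> 'a. bounded_linear f \<and> (\<forall>c x. f (c *\<^sub>C x) = c *\<^sub>C f x)}"
  morphisms bop_apply Bop
  by (rule exI [of _ "\<lambda>x. x"]) (simp add: bounded_linear_ident)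

setup_lifting type_definition_bop

instantiation bop :: (chilbert_space) "{ring, monoid_mult, scaleC}"
begin

lift_definition zero_bop :: "'a bop" is "\<lambda>x. 0"
  by (simp add: scaleC_zero_right bounded_linear_zero)

lift_definition one_bop :: "'a bop" is "\<lambda>x. x"
  by (simp add: bounded_linear_ident)

lift_definition plus_bop :: "'a bop \<Rightarrow> 'a bop \<Rightarrow> 'a bop" is "\<lambda>f g x. f x + g x"
  by (simp add: scaleC_add_right bounded_linear_add)

lift_definition uminus_bop :: "'a bop \<Rightarrow> 'a bop" is "\<lambda>f x. - f x"
  by (simp add: scaleC_minus_right bounded_linear_minus)

lift_definition minus_bop :: "'a bop \<Rightarrow> 'a bop \<Rightarrow> 'a bop" is "\<lambda>f g x. f x - g x"
  by (simp add: scaleC_add_right scaleC_minus_right bounded_linear_sub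
      diff_conv_add_uminus del: add_uminus_conv_diff)
     (metis bounded_linear_add bounded_linear_minus)

lift_definition times_bop :: "'a bop \<Rightarrow> 'a bop \<Rightarrow> 'a bop" is "\<lambda>f g x. f (g x)"
  by (simp add: bounded_linear_compose)

lift_definition scaleC_bop :: "complex \<Rightarrow> 'a bop \<Rightarrow> 'a bop" is "\<lambda>c f x. c *\<^sub>C f x"
  by (simp add: scaleC_scaleC mult.commute bounded_linear_compose [OF bounded_linear_scaleC])

instance
proof
  fix A B C :: "'a bop"
  show "A + B + C = A + (B + C)" by transfer (simp add: add.assoc)
  show "A + B = B + A" by transfer (simp add: add.commute)
  show "0 + A = A" by transfer simp
  show "- A + A = 0" by transfer simp
  show "A - B = A + - B" by transfer simp
  show "A * B * C = A * (B * C)" by transfer simp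
  show "(A + B) * C = A * C + B * C" by transfer simp
  show "A * (B + C) = A * B + A * C"
    by transfer (auto simp: linear_add bounded_linear.linear)
  show "1 * A = A" by transfer simp
  show "A * 1 = A" by transfer simp
qed

end

definition is_adjoint :: "'a::chilbert_space bop \<Rightarrow> 'a bop \<Rightarrow> bool" where
  "is_adjoint A B \<longleftrightarrow> (\<forall>x y. cinner (bop_apply A x) y = cinner x (bop_apply B y))"

definition self_adjoint :: "'a::chilbert_space bop \<Rightarrow> bool" where
  "self_adjoint A \<longleftrightarrow> is_adjoint A A"

definition is_projection :: "'a::chilbert_space bop \<Rightarrow> bool" where
  "is_projection A \<longleftrightarrow> self_adjoint A \<and> A * A = A"

definition bop_le :: "'a::chilbert_space bop \<Rightarrow> 'a bop \<Rightarrow> bool"  (infix "\<le>\<^sub>o\<^sub>p" 50) where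
  "A \<le>\<^sub>o\<^sub>p B \<longleftrightarrow> (\<forall>x. cinner x (bop_apply (B - A) x) \<in> \<real>\<^sub>\<ge>\<^sub>0)"

text \<open>The coarsest topology making all \<open>A \<mapsto> \<langle>x, A y\<rangle>\<close> continuous: \<^const>\<open>euclidean\<close> on a
  function type is the product topology.\<close>

definition weak_operator_topology :: "'a::chilbert_space bop topology" where
  "weak_operator_topology =
     pullback_topology UNIV (\<lambda>A (x, y). cinner x (bop_apply A y)) euclidean"

definition von_neumann_algebra :: "'a::chilbert_space bop set \<Rightarrow> bool" where
  "von_neumann_algebra U \<longleftrightarrow>
     1 \<in> U \<and>
     (\<forall>A\<in>U. \<forall>B\<in>U. A + B \<in> U) \<and>
     (\<forall>c. \<forall>A\<in>U. c *\<^sub>C A \<in> U) \<and>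
     (\<forall>A\<in>U. \<forall>B\<in>U. A * B \<in> U) \<and>
     (\<forall>A\<in>U. \<exists>B\<in>U. is_adjoint A B) \<and>
     closedin weak_operator_topology U"

definition center :: "'a::ring set \<Rightarrow> 'a set" where
  "center U = {Z \<in> U. \<forall>A\<in>U. Z * A = A * Z}"

text \<open>The summand \<open>U E\<close>, for a central projection \<open>E\<close>; its unit is \<open>E\<close>, and it is a von Neumann
  algebra on the range of \<open>E\<close>.\<close>

definition summand :: "'a::ring set \<Rightarrow> 'a \<Rightarrow> 'a set" where
  "summand U E = (\<lambda>A. A * E) ` U"

definition type_I1 :: "'a::ring set \<Rightarrow> bool" where
  "type_I1 M \<longleftrightarrow> (\<forall>A\<in>M. \<forall>B\<in>M. A * B = B * A)"

definition no_central_summand_I1 :: "'a::chilbert_space bop set \<Rightarrow> bool" where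
  "no_central_summand_I1 M \<longleftrightarrow>
     \<not> (\<exists>Q\<in>center M. is_projection Q \<and> Q \<noteq> 0 \<and> type_I1 (summand M Q))"

definition is_central_carrier ::
  "'a::chilbert_space bop set \<Rightarrow> 'a bop \<Rightarrow> 'a bop \<Rightarrow> bool" where
  "is_central_carrier U T Q \<longleftrightarrow>
     Q \<in> center U \<and> is_projection Q \<and> Q * T = T \<and>
     (\<forall>R\<in>center U. is_projection R \<longrightarrow> R * T = T \<longrightarrow> Q \<le>\<^sub>o\<^sub>p R)"

text \<open>\<open>is_core U S K\<close> says that \<open>K\<close> is the core of \<open>S\<close>, the supremum being taken in the partially
  ordered set of self-adjoint elements of the center.\<close>

definition is_core :: "'a::chilbert_space bop set \<Rightarrow> 'a bop \<Rightarrow> 'a bop \<Rightarrow> bool" where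
  "is_core U S K \<longleftrightarrow>
     K \<in> center U \<and> self_adjoint K \<and>
     (\<forall>W\<in>center U. self_adjoint W \<longrightarrow> W \<le>\<^sub>o\<^sub>p S \<longrightarrow> W \<le>\<^sub>o\<^sub>p K) \<and>
     (\<forall>V\<in>center U. self_adjoint V \<longrightarrow>
        (\<forall>W\<in>center U. self_adjoint W \<longrightarrow> W \<le>\<^sub>o\<^sub>p S \<longrightarrow> W \<le>\<^sub>o\<^sub>p V) \<longrightarrow> K \<le>\<^sub>o\<^sub>p V)"

definition core_free :: "'a::chilbert_space bop set \<Rightarrow> 'a bop \<Rightarrow> bool" where
  "core_free U P \<longleftrightarrow> is_core U P 0"

definition commutator :: "'a::ring \<Rightarrow> 'a \<Rightarrow> 'a" where
  "commutator A B = A * B - B * A"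

text \<open>\<open>pn n A\<close> is \<open>p\<^sub>n(A 1, \<dots>, A n)\<close>; the value at \<open>n = 0\<close> is a dummy.\<close>

fun pn :: "nat \<Rightarrow> (nat \<Rightarrow> 'a::ring) \<Rightarrow> 'a" where
  "pn 0 A = 0"
| "pn (Suc 0) A = A 1"
| "pn (Suc (Suc k)) A = commutator (pn (Suc k) A) (A (Suc (Suc k)))"

definition additive_map_on :: "'a::ring set \<Rightarrow> ('a \<Rightarrow> 'a) \<Rightarrow> bool" where
  "additive_map_on U f \<longleftrightarrow>
     (\<forall>A\<in>U. f A \<in> U) \<and> (\<forall>A\<in>U. \<forall>B\<in>U. f (A + B) = f A + f B)"

end

theory Submission
  imports Defs
begin

text \<open>
  The difference \<open>D = G - L\<close> satisfies
  \<open>D (p\<^sub>n(A\<^sub>1, \<dots>, A\<^sub>n)) = p\<^sub>n(D A\<^sub>1, A\<^sub>2, \<dots>) = p\<^sub>n(A\<^sub>1, D A\<^sub>2, \<dots>)\<close> whenever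
  \<open>A\<^sub>1 A\<^sub>2 = P\<close>, and it suffices to find a central \<open>W\<close> such that every \<open>D A - W A\<close> is central.
  Write \<open>e = P\<close> and \<open>f = E\<^sub>2 - P\<close>. Factorizations of \<open>e\<close> into elements invertible in \<open>e U e\<close>, and
  \<open>e = e (e + b)\<close> with \<open>b\<close> in \<open>f U f\<close>, show that \<open>D e\<close> commutes with \<open>e U e\<close> and with \<open>f U f\<close>. In
  a von Neumann algebra the center of a corner consists of the compressions of central elements,
  so \<open>D e e = z' e\<close> and \<open>D e f = z f\<close> with \<open>z, z'\<close> central, and after subtracting
  \<open>W = z' - z\<close> from \<open>D\<close> one may assume that \<open>D e\<close> is central. Then \<open>D\<close> vanishes on \<open>e U f\<close> and
  \<open>f U e\<close>, and the values of \<open>D\<close> on the other Peirce components commute with \<open>e\<close> and \<open>e U f\<close>.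
  Because \<open>P\<close> is core-free with central carrier \<open>E\<^sub>2\<close>, no nonzero element of \<open>U E\<^sub>2\<close> annihilates
  \<open>U e\<close> or \<open>U f\<close>, and this forces such values to be central.
\<close>

section \<open>Bounded operators on a Hilbert space\<close>

text \<open>The only topological input is that \<open>U\<close> is closed in the strong operator
  topology. It is exploited through one fact: a strongly closed two-sided ideal of \<open>U\<close>
  has a central projection as unit. For the annihilator of \<open>U e\<close> or of
  \<open>U f\<close> this gives the faithfulness statements. For the strong closure of the ideal
  generated by a projection \<open>p\<close> it shows that \<open>E\<^sub>2\<close> is a strong
  limit of finite sums of terms \<open>A p B\<close>. To extend an element \<open>c\<close> of the
  center of \<open>p U p\<close>, the terms \<open>A p B\<close> are replaced by
  \<open>A c B\<close>; the obstacle is a bound for the new sums by the old ones that does not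
  depend on the number of terms.

  The length n of the commutators disappears early: an element whose k-fold commutators with
  \<open>U\<close> are all central is itself central, because the center has no nonzero element of
  square zero. This leaves identities modulo the center, many of which become exact by looking at
  the position of the central element relative to \<open>e\<close>. Working modulo the center also
  absorbs the abelian summand, since \<open>(1 - E\<^sub>2) U\<close> is central.\<close>

lemma mult_absorb: "a * b = c \<Longrightarrow> a * (b * x) = c * (x :: 'a::semigroup_mult)"
  by (simp add: mult.assoc [symmetric])

notation bop_apply (infixr "\<star>" 68)

lemma bop_apply_zero [simp]: "0 \<star> x = 0"
  by transfer simp

lemma bop_apply_one [simp]: "1 \<star> x = x"
  by transfer simp

lemma bop_apply_plus [simp]: "(A + B) \<star> x = (A \<star> x) + (B \<star> x)"
  by transfer simp

lemma bop_apply_minus [simp]: "(A - B) \<star> x = (A \<star> x) - (B \<star> x)"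
  by transfer simp

lemma bop_apply_uminus [simp]: "(- A) \<star> x = - (A \<star> x)"
  by transfer simp

lemma bop_apply_times [simp]: "(A * B) \<star> x = A \<star> B \<star> x"
  by transfer simp

lemma bop_apply_scaleC [simp]: "(c *\<^sub>C A) \<star> x = c *\<^sub>C (A \<star> x)"
  by transfer simp

lemma bounded_linear_bop_apply: "bounded_linear (bop_apply A)"
  using bop_apply [of A] by simp

lemma bop_apply_scaleC_right: "A \<star> (c *\<^sub>C x) = c *\<^sub>C (A \<star> x)"
  using bop_apply [of A] by simp

lemma bop_apply_add_right: "A \<star> (x + y) = (A \<star> x) + (A \<star> y)"
  by (rule bounded_linear_bop_apply [THEN bounded_linear.linear, THEN linear_add])

lemma bop_apply_diff_right: "A \<star> (x - y) = (A \<star> x) - (A \<star> y)"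
  by (rule bounded_linear_bop_apply [THEN bounded_linear.linear, THEN linear_diff])

lemma scaleC_diff_right: "c *\<^sub>C (x - y) = c *\<^sub>C x - c *\<^sub>C (y::'a::chilbert_space)"
  using scaleC_add_right [of c x "- y"] by (simp add: scaleC_minus_right)

lemma bop_eqI: "(\<And>x. A \<star> x = B \<star> x) \<Longrightarrow> A = B"
  by (simp add: bop_apply_inject [symmetric] fun_eq_iff)

lemma scaleC_times_scaleC: "(c *\<^sub>C A) * (d *\<^sub>C B) = (c * d) *\<^sub>C (A * B :: 'a::chilbert_space bop)"
  by (rule bop_eqI) (simp add: bop_apply_scaleC_right scaleC_scaleC mult.commute)

lemma scaleC_one_bop: "1 *\<^sub>C A = (A :: 'a::chilbert_space bop)"
proof (rule bop_eqI)
  show "(1 *\<^sub>C A) \<star> x = A \<star> x" for x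
    using scaleC_of_real [of 1 "A \<star> x"] by simp
qed

lemma bop_bound:
  obtains b where "b > 0" "\<And>x. norm (A \<star> x) \<le> b * norm x"
  using bounded_linear.pos_bounded [OF bounded_linear_bop_apply [of A]]
  by (auto simp: mult.commute)

lemma tendsto_bop_apply [tendsto_intros]:
  "(f \<longlongrightarrow> l) F \<Longrightarrow> ((\<lambda>i. A \<star> f i) \<longlongrightarrow> A \<star> l) F"
  by (rule bounded_linear.tendsto [OF bounded_linear_bop_apply])

section \<open>Inner products and adjoints\<close>

lemma cinner_add_left: "cinner (x + y) z = cinner x z + cinner y (z::'a::chilbert_space)"
  by (metis cinner_commute cinner_add_right complex_cnj_add)

lemma cinner_zero_right [simp]: "cinner x (0::'a::chilbert_space) = 0"
  using cinner_add_right [of x 0 0] by simp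

lemma cinner_zero_left [simp]: "cinner (0::'a::chilbert_space) x = 0"
  by (metis cinner_commute cinner_zero_right complex_cnj_zero)

lemma cinner_minus_right: "cinner x (- y) = - cinner x (y::'a::chilbert_space)"
  using cinner_add_right [of x y "- y"] by (simp add: eq_neg_iff_add_eq_0 add.commute)

lemma cinner_minus_left: "cinner (- x) y = - cinner x (y::'a::chilbert_space)"
  by (metis cinner_commute cinner_minus_right complex_cnj_minus)

lemma cinner_diff_right: "cinner x (y - z) = cinner x y - cinner x (z::'a::chilbert_space)"
  using cinner_add_right [of x y "- z"] by (simp add: cinner_minus_right)

lemma cinner_diff_left: "cinner (x - y) z = cinner x z - cinner y (z::'a::chilbert_space)"
  using cinner_add_left [of x "- y" z] by (simp add: cinner_minus_left)

text \<open>Cauchy-Schwarz: \<open>c\<close> is the coefficient of the orthogonal projection of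
  \<open>x\<close> onto the line through \<open>y\<close>, and the squared norm of the remainder is
  nonnegative.\<close>

lemma norm_cinner_le: "cmod (cinner x y) \<le> norm x * norm (y::'a::chilbert_space)"
proof (cases "y = 0")
  case False
  define c where "c = cinner y x / complex_of_real ((norm y)\<^sup>2)"
  have ny: "(norm y)\<^sup>2 > 0" using False by simp
  define s where "s = cmod (cinner x y)"
  have xy: "cinner x y * cinner y x = complex_of_real (s\<^sup>2)"
    using complex_norm_square [of "cinner x y"] cinner_commute [of y x] by (simp add: s_def)
  have cc: "cnj c = cinner x y / complex_of_real ((norm y)\<^sup>2)"
    using cinner_commute [of x y] by (simp add: c_def)
  have "complex_of_real ((norm (x - c *\<^sub>C y))\<^sup>2)
      = cinner x x - c * cinner x y - cnj c * cinner y x + cnj c * c * cinner y y"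
    unfolding cinner_self [symmetric]
    by (simp add: cinner_diff_left cinner_diff_right cinner_scaleC_left cinner_scaleC_right
        algebra_simps)
  also have "\<dots> = cinner x x - (cinner x y * cinner y x) / complex_of_real ((norm y)\<^sup>2)"
    unfolding cc unfolding c_def cinner_self [of y] using ny by (simp add: field_simps)
  also have "\<dots> = complex_of_real ((norm x)\<^sup>2 - s\<^sup>2 / (norm y)\<^sup>2)"
    unfolding xy cinner_self by simp
  finally have "(norm (x - c *\<^sub>C y))\<^sup>2 = (norm x)\<^sup>2 - s\<^sup>2 / (norm y)\<^sup>2"
    by (simp only: of_real_eq_iff)
  then have "s\<^sup>2 / (norm y)\<^sup>2 \<le> (norm x)\<^sup>2"
    by (metis diff_ge_0_iff_ge zero_le_power2)
  then have "s\<^sup>2 \<le> (norm x * norm y)\<^sup>2"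
    using ny by (simp add: power_mult_distrib divide_le_eq)
  then show ?thesis
    unfolding s_def by (rule power2_le_imp_le) simp
qed simp

lemma tendsto_cinner:
  assumes "(f \<longlongrightarrow> a) F" "(g \<longlongrightarrow> b) F"
  shows "((\<lambda>i. cinner (f i) (g i)) \<longlongrightarrow> cinner a (b::'a::chilbert_space)) F"
proof -
  have "((\<lambda>i. norm (f i - a) * norm (g i) + norm a * norm (g i - b)) \<longlongrightarrow>
      norm (a - a) * norm b + norm a * norm (b - b)) F"
    by (intro tendsto_intros assms)
  then have lim: "((\<lambda>i. norm (f i - a) * norm (g i) + norm a * norm (g i - b)) \<longlongrightarrow> 0) F"
    by simp
  have "cmod (cinner (f i) (g i) - cinner a b) \<le> norm (f i - a) * norm (g i) + norm a * norm (g i - b)"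
    for i
  proof -
    have "cinner (f i) (g i) - cinner a b = cinner (f i - a) (g i) + cinner a (g i - b)"
      by (simp add: cinner_diff_left cinner_diff_right)
    then show ?thesis
      by (metis norm_triangle_mono norm_cinner_le)
  qed
  then have "((\<lambda>i. cinner (f i) (g i) - cinner a b) \<longlongrightarrow> 0) F"
    by (intro Lim_null_comparison [OF _ lim]) simp
  then show ?thesis
    by (simp add: LIM_zero_iff)
qed

lemma is_adjointD: "is_adjoint A B \<Longrightarrow> cinner (A \<star> x) y = cinner x (B \<star> y)"
  by (simp add: is_adjoint_def)

lemma is_adjoint_sym: "is_adjoint A B \<Longrightarrow> is_adjoint B A"
  unfolding is_adjoint_def by (metis cinner_commute)

lemma cinner_eqI:
  assumes "\<And>x. cinner x y = cinner x (z::'a::chilbert_space)"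
  shows "y = z"
proof -
  have "complex_of_real ((norm (y - z))\<^sup>2) = 0"
    unfolding cinner_self [symmetric] by (subst cinner_diff_right) (simp add: assms)
  then show ?thesis
    by (metis norm_eq_zero of_real_eq_0_iff right_minus_eq zero_eq_power2)
qed

lemma is_adjoint_unique:
  assumes "is_adjoint A B" "is_adjoint A C"
  shows "B = C"
proof (rule bop_eqI)
  show "B \<star> y = C \<star> y" for y
    by (rule cinner_eqI) (use assms in \<open>simp add: is_adjoint_def\<close>)
qed

lemma is_adjoint_times: "is_adjoint A B \<Longrightarrow> is_adjoint C D \<Longrightarrow> is_adjoint (A * C) (D * B)"
  by (simp add: is_adjoint_def)

lemma is_adjoint_minus: "is_adjoint A B \<Longrightarrow> is_adjoint C D \<Longrightarrow> is_adjoint (A - C) (B - D)"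
  by (simp add: is_adjoint_def cinner_diff_left cinner_diff_right)

lemma is_adjoint_plus: "is_adjoint A B \<Longrightarrow> is_adjoint C D \<Longrightarrow> is_adjoint (A + C) (B + D)"
  by (simp add: is_adjoint_def cinner_add_left cinner_add_right)

lemma is_adjoint_zero [simp]: "is_adjoint 0 0"
  by (simp add: is_adjoint_def)

lemma is_adjoint_one [simp]: "is_adjoint 1 1"
  by (simp add: is_adjoint_def)

lemma is_adjoint_scaleR:
  "is_adjoint A B \<Longrightarrow> is_adjoint (complex_of_real r *\<^sub>C A) (complex_of_real r *\<^sub>C B)"
  by (simp add: is_adjoint_def cinner_scaleC_left cinner_scaleC_right)

lemma is_adjoint_eq_0_iff: "is_adjoint A B \<Longrightarrow> A = 0 \<longleftrightarrow> B = 0"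
  using is_adjoint_unique is_adjoint_sym is_adjoint_zero by blast

text \<open>The quadratic form of \<open>B * A\<close> at \<open>x\<close> is the squared norm of
  \<open>A\<close> applied to \<open>x\<close>.\<close>

lemma adjoint_times_self_eq_0:
  assumes "is_adjoint A B" "B * A = 0"
  shows "A = 0"
proof (rule bop_eqI)
  fix x
  have "complex_of_real ((norm (A \<star> x))\<^sup>2) = cinner x ((B * A) \<star> x)"
    using assms(1) by (simp add: cinner_self [symmetric] is_adjointD del: of_real_power)
  then show "A \<star> x = 0 \<star> x"
    by (simp add: assms(2))
qed

section \<open>Projections and strong limits of operators\<close>

lemma is_projectionD:
  assumes "is_projection R"
  shows "is_adjoint R R" "R * R = R" "R \<star> R \<star> x = R \<star> x"
proof -
  show "is_adjoint R R" "R * R = R"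
    using assms by (auto simp: is_projection_def self_adjoint_def)
  then show "R \<star> R \<star> x = R \<star> x"
    by (metis bop_apply_times)
qed

lemma cinner_projection:
  assumes "is_projection R"
  shows "cinner x (R \<star> x) = complex_of_real ((norm (R \<star> x))\<^sup>2)"
  using is_projectionD [OF assms] by (metis cinner_self is_adjointD)

lemma norm_projection_le:
  assumes "is_projection R"
  shows "norm (R \<star> x) \<le> norm x"
proof -
  have "(norm (R \<star> x))\<^sup>2 = cmod (cinner x (R \<star> x))"
    by (simp only: cinner_projection [OF assms] norm_of_real) simp
  also have "\<dots> \<le> norm x * norm (R \<star> x)"
    by (rule norm_cinner_le)
  finally have "norm (R \<star> x) * norm (R \<star> x) \<le> norm x * norm (R \<star> x)"
    by (simp add: power2_eq_square)
  then show ?thesis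
    by (metis mult_right_le_imp_le norm_ge_zero order_le_less)
qed

lemma is_projection_minus:
  assumes "is_projection R" "is_projection S" "R * S = S" "S * R = S"
  shows "is_projection (R - S)"
  using assms unfolding is_projection_def self_adjoint_def
  by (simp add: is_adjoint_minus algebra_simps)

lemma is_projection_zero [simp]: "is_projection 0"
  by (simp add: is_projection_def self_adjoint_def)

lemma is_projection_one [simp]: "is_projection 1"
  by (simp add: is_projection_def self_adjoint_def)

lemma is_projection_times:
  assumes "is_projection R" "is_projection S" "R * S = S * R"
  shows "is_projection (R * S)"
proof -
  have "R * S * (R * S) = R * (S * R) * S"
    by (simp add: mult.assoc)
  also have "\<dots> = R * S"
    by (metis assms(3) is_projectionD(2) [OF assms(1)] is_projectionD(2) [OF assms(2)] mult.assoc)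
  finally show ?thesis
    using assms is_adjoint_times [of R R S S] by (simp add: is_projection_def self_adjoint_def)
qed

text \<open>The bound is required of the limit vectors only, because the net used for the center of
  a corner consists of operators with no common bound.\<close>

lemma bop_limit:
  fixes A :: "'i \<Rightarrow> 'a::chilbert_space bop"
  assumes F: "F \<noteq> bot"
    and conv: "\<And>x. \<exists>l. ((\<lambda>i. A i \<star> x) \<longlongrightarrow> l) F"
    and bound: "\<And>x l. ((\<lambda>i. A i \<star> x) \<longlongrightarrow> l) F \<Longrightarrow> norm l \<le> b * norm x"
  shows "\<exists>T. \<forall>x. ((\<lambda>i. A i \<star> x) \<longlongrightarrow> T \<star> x) F"
proof -
  obtain t where t: "\<And>x. ((\<lambda>i. A i \<star> x) \<longlongrightarrow> t x) F"
    using conv by metis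
  have add: "t (x + y) = t x + t y" for x y
    using tendsto_unique [OF F t [of "x + y"]] tendsto_add [OF t [of x] t [of y]]
    by (simp add: bop_apply_add_right)
  have scaleC: "t (c *\<^sub>C x) = c *\<^sub>C t x" for c x
    using tendsto_unique [OF F t [of "c *\<^sub>C x"]]
      bounded_linear.tendsto [OF bounded_linear_scaleC t [of x], of c]
    by (simp add: bop_apply_scaleC_right)
  have "bounded_linear t"
  proof (rule bounded_linear_intro)
    show "norm (t x) \<le> norm x * b" for x
      using bound [OF t [of x]] by (simp add: mult.commute)
    show "t (r *\<^sub>R x) = r *\<^sub>R t x" for r x
      by (metis scaleC scaleC_of_real)
  qed (rule add)
  then have "bop_apply (Bop t) = t"
    using scaleC by (simp add: Bop_inverse)
  then show ?thesis
    using t by (intro exI [of _ "Bop t"]) simp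
qed

text \<open>A Cauchy criterion for nets: the values need only gather near some \<open>y\<close>,
  which may vary with \<open>e\<close>. Sequences do not suffice, since the Hilbert space may be
  nonseparable.\<close>

lemma convergent_filter_Cauchy:
  fixes g :: "'i \<Rightarrow> 'a::banach"
  assumes "F \<noteq> bot"
    and "\<And>e. e > 0 \<Longrightarrow> \<exists>y. eventually (\<lambda>i. dist (g i) y < e) F"
  shows "\<exists>l. (g \<longlongrightarrow> l) F"
proof -
  have "\<exists>P. eventually P F \<and> (\<forall>i j. P i \<and> P j \<longrightarrow> dist (g i) (g j) < e)" if e: "e > 0" for e
  proof -
    obtain y where y: "eventually (\<lambda>i. dist (g i) y < e / 2) F"
      using assms(2) [of "e / 2"] e by auto
    then show ?thesis
      using dist_triangle_half_l by blast
  qed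
  then have "cauchy_filter (filtermap g F)"
    by (simp add: cauchy_filter_metric_filtermap)
  moreover have "complete (UNIV::'a set)"
    by (rule complete_UNIV)
  ultimately show ?thesis
    using complete_uniform [where S="UNIV::'a set"] assms(1)
    by (force simp: filterlim_def filtermap_bot_iff)
qed

section \<open>Strongly closed sets of operators\<close>

text \<open>Closedness in the strong operator topology, expressed by basic neighbourhoods: every
  such neighbourhood of \<open>T\<close> meets \<open>S\<close>.\<close>

definition strongly_closed :: "'a::chilbert_space bop set \<Rightarrow> bool" where
  "strongly_closed S \<longleftrightarrow>
     (\<forall>T. (\<forall>X e. finite X \<longrightarrow> e > 0 \<longrightarrow> (\<exists>A\<in>S. \<forall>x\<in>X. norm ((A - T) \<star> x) < e)) \<longrightarrow> T \<in> S)"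

lemma strongly_closed_limit:
  fixes T :: "'a::chilbert_space bop"
  assumes "strongly_closed S" "F \<noteq> bot" "eventually (\<lambda>i. A i \<in> S) F"
    and lim: "\<And>x. ((\<lambda>i. A i \<star> x) \<longlongrightarrow> T \<star> x) F"
  shows "T \<in> S"
proof -
  have "\<exists>B\<in>S. \<forall>x\<in>X. norm ((B - T) \<star> x) < e" if "finite X" "e > 0" for X e
  proof -
    have "eventually (\<lambda>i. \<forall>x\<in>X. norm ((A i - T) \<star> x) < e) F"
    proof (rule eventually_ball_finite [OF \<open>finite X\<close>], rule ballI)
      show "eventually (\<lambda>i. norm ((A i - T) \<star> x) < e) F" for x
        using tendstoD [OF lim [of x] \<open>e > 0\<close>] by (simp add: dist_norm)
    qed
    then have "eventually (\<lambda>i. A i \<in> S \<and> (\<forall>x\<in>X. norm ((A i - T) \<star> x) < e)) F"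
      using assms(3) by (rule eventually_conj [rotated])
    then show ?thesis
      using eventually_happens' [OF \<open>F \<noteq> bot\<close>] by blast
  qed
  then show ?thesis
    using assms(1) unfolding strongly_closed_def by blast
qed

text \<open>A basic weak neighbourhood constrains finitely many pairs \<open>(x, y)\<close>; by
  Cauchy-Schwarz it contains a strong neighbourhood that tests the vectors \<open>y\<close>.\<close>

lemma strongly_closed_weak_operator:
  fixes U :: "'a::chilbert_space bop set"
  assumes "closedin weak_operator_topology U"
  shows "strongly_closed U"
  unfolding strongly_closed_def
proof (intro allI impI, rule ccontr)
  fix T :: "'a bop"
  assume approx: "\<forall>X e. finite X \<longrightarrow> e > 0 \<longrightarrow> (\<exists>A\<in>U. \<forall>x\<in>X. norm ((A - T) \<star> x) < e)"
    and "T \<notin> U"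
  define \<phi> :: "'a bop \<Rightarrow> 'a \<times> 'a \<Rightarrow> complex" where "\<phi> = (\<lambda>A (x, y). cinner x (A \<star> y))"
  have "topspace (weak_operator_topology :: 'a bop topology) = UNIV"
    by (simp add: weak_operator_topology_def topspace_pullback_topology)
  then obtain V where V: "open V" and UV: "- U = \<phi> -` V"
    using assms unfolding closedin_def weak_operator_topology_def openin_pullback_topology \<phi>_def
    by (auto simp: Compl_eq_Diff_UNIV)
  have "\<phi> T \<in> V"
    using UV \<open>T \<notin> U\<close> by blast
  then obtain W where W: "finite {i. W i \<noteq> UNIV}" "\<And>i. open (W i)" "\<phi> T \<in> Pi\<^sub>E UNIV W"
      "Pi\<^sub>E UNIV W \<subseteq> V"
    using V unfolding open_fun_def openin_product_topology_alt by (auto simp: PiE_UNIV_domain)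
  define I where "I = {i. W i \<noteq> UNIV}"
  have "\<forall>i. \<exists>r>0. ball (\<phi> T i) r \<subseteq> W i"
    using W(2,3) by (metis PiE_mem UNIV_I openE)
  then obtain r where r: "\<And>i. r i > 0" "\<And>i. ball (\<phi> T i) (r i) \<subseteq> W i"
    by metis
  \<comment> \<open>The summand 1 in the denominator avoids division by zero when
    \<open>x = 0\<close>, and inserting 1 keeps the set nonempty when no coordinate is
    constrained.\<close>
  define d where "d = Min (insert 1 ((\<lambda>i. r i / (norm (fst i) + 1)) ` I))"
  have "finite I" using W(1) by (simp add: I_def)
  have "d > 0"
    unfolding d_def using \<open>finite I\<close> r(1) by (subst Min_gr_iff) (auto intro!: divide_pos_pos add_nonneg_pos)
  obtain A where A: "A \<in> U" "\<And>x. x \<in> snd ` I \<Longrightarrow> norm ((A - T) \<star> x) < d"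
    using approx \<open>finite I\<close> \<open>d > 0\<close> by (meson finite_imageI)
  have "\<phi> A i \<in> W i" for i
  proof (cases "i \<in> I")
    case True
    obtain x y where i: "i = (x, y)" by (cases i)
    have "d \<le> r i / (norm x + 1)"
      unfolding d_def using \<open>finite I\<close> True i by (intro Min_le) force+
    then have d: "(norm x + 1) * d \<le> r i"
      by (simp add: pos_le_divide_eq add_nonneg_pos mult.commute)
    have "dist (\<phi> T i) (\<phi> A i) = cmod (cinner x ((A - T) \<star> y))"
      by (simp add: \<phi>_def i dist_norm cinner_diff_right norm_minus_commute)
    also have "\<dots> \<le> norm x * norm ((A - T) \<star> y)"
      by (rule norm_cinner_le)
    also have "\<dots> \<le> norm x * d"
      using A(2) [of y] True i by (intro mult_left_mono) force+
    also have "\<dots> < (norm x + 1) * d"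
      using \<open>d > 0\<close> by (simp add: algebra_simps)
    finally show ?thesis
      using d r(2) [of i] by (auto simp: mem_ball)
  next
    case False
    then show ?thesis by (simp add: I_def)
  qed
  then have "\<phi> A \<in> V"
    using W(4) by (auto simp: PiE_UNIV_domain)
  then show False
    using UV A(1) by blast
qed

section \<open>Strongly closed ideals\<close>

locale vn_algebra =
  fixes U :: "'a::chilbert_space bop set"
  assumes vn: "von_neumann_algebra U"
begin

lemma one_in: "1 \<in> U"
  and plus_in: "A \<in> U \<Longrightarrow> B \<in> U \<Longrightarrow> A + B \<in> U"
  and scaleC_in: "A \<in> U \<Longrightarrow> c *\<^sub>C A \<in> U"
  and times_in: "A \<in> U \<Longrightarrow> B \<in> U \<Longrightarrow> A * B \<in> U"
  and adjoint_in: "A \<in> U \<Longrightarrow> \<exists>B\<in>U. is_adjoint A B"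
  and strongly_closed: "strongly_closed U"
  using vn strongly_closed_weak_operator by (auto simp: von_neumann_algebra_def)

lemma uminus_in: "A \<in> U \<Longrightarrow> - A \<in> U"
proof -
  assume "A \<in> U"
  then have "(-1) *\<^sub>C A \<in> U" by (rule scaleC_in)
  moreover have "(-1) *\<^sub>C A = - A"
  proof (rule bop_eqI)
    show "((-1) *\<^sub>C A) \<star> x = (- A) \<star> x" for x
      using scaleC_of_real [of "-1" "A \<star> x"] by simp
  qed
  ultimately show ?thesis by simp
qed

lemma minus_in: "A \<in> U \<Longrightarrow> B \<in> U \<Longrightarrow> A - B \<in> U"
  using plus_in [of A "- B"] uminus_in [of B] by simp

lemma zero_in: "0 \<in> U"
  using minus_in [OF one_in one_in] by simp

lemma center_in: "Z \<in> center U \<Longrightarrow> Z \<in> U"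
  and center_commute: "Z \<in> center U \<Longrightarrow> A \<in> U \<Longrightarrow> Z * A = A * Z"
  by (auto simp: center_def)

definition two_sided_ideal :: "'a bop set \<Rightarrow> bool" where
  "two_sided_ideal J \<longleftrightarrow> J \<subseteq> U \<and> 0 \<in> J \<and> (\<forall>A\<in>J. \<forall>B\<in>J. A + B \<in> J) \<and>
     (\<forall>A\<in>J. \<forall>B\<in>U. A * B \<in> J \<and> B * A \<in> J)"

lemma ideal_scaleC:
  assumes "two_sided_ideal J" "A \<in> J"
  shows "c *\<^sub>C A \<in> J"
proof -
  have "(c *\<^sub>C 1) * A \<in> J"
    using assms scaleC_in [OF one_in] by (auto simp: two_sided_ideal_def)
  moreover have "(c *\<^sub>C 1) * A = c *\<^sub>C A"
    by (rule bop_eqI) simp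
  ultimately show ?thesis by simp
qed

text \<open>With \<open>B = 1 - h / M\<close> the even powers of \<open>B\<close> converge strongly, and the limit is the
  projection onto the kernel of \<open>h\<close>.\<close>

lemma ideal_kernel_projection:
  assumes J: "two_sided_ideal J" "strongly_closed J" and h: "h \<in> J" "is_adjoint h h"
    and pos: "\<And>x. 0 \<le> Re (cinner x (h \<star> x))"
  obtains N where "is_projection N" "1 - N \<in> J" "h * N = 0"
proof -
  have JU: "J \<subseteq> U" and Jplus: "\<And>A B. A \<in> J \<Longrightarrow> B \<in> J \<Longrightarrow> A + B \<in> J"
    and Jtimes: "\<And>A B. A \<in> J \<Longrightarrow> B \<in> U \<Longrightarrow> A * B \<in> J"
    using J(1) by (auto simp: two_sided_ideal_def)
  obtain M where M: "M > 0" "\<And>x. norm (h \<star> x) \<le> M * norm x"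
    using bop_bound [of h] by blast
  define k where "k = complex_of_real (1 / M) *\<^sub>C h"
  define B where "B = 1 - k"
  have kJ: "k \<in> J"
    unfolding k_def by (rule ideal_scaleC [OF J(1) h(1)])
  have BU: "B \<in> U"
    unfolding B_def using kJ JU by (intro minus_in one_in) auto
  have adj_k: "is_adjoint k k"
    unfolding k_def by (rule is_adjoint_scaleR [OF h(2)])
  have adj_B: "is_adjoint B B"
    unfolding B_def by (intro is_adjoint_minus is_adjoint_one adj_k)
  have k_apply: "k \<star> x = complex_of_real (1 / M) *\<^sub>C (h \<star> x)" for x
    by (simp add: k_def)
  have Re_k: "Re (cinner x (k \<star> x)) = Re (cinner x (h \<star> x)) / M" for x
    by (simp add: k_apply cinner_scaleC_right)
  have k_pos: "0 \<le> Re (cinner x (k \<star> x))" for x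
    using pos [of x] M(1) by (simp add: Re_k)
  have k_le: "Re (cinner x (k \<star> x)) \<le> (norm x)\<^sup>2" for x
  proof -
    have "Re (cinner x (h \<star> x)) \<le> norm x * (M * norm x)"
      using norm_cinner_le [of x "h \<star> x"] complex_Re_le_cmod [of "cinner x (h \<star> x)"] M(2) [of x]
      by (meson mult_left_mono norm_ge_zero order_trans)
    then show ?thesis
      using M(1) by (simp add: Re_k pos_divide_le_eq power2_eq_square algebra_simps)
  qed
  have norm_sq: "(norm x)\<^sup>2 = Re (cinner x x)" for x :: 'a
    by (simp add: cinner_self)
  have B_apply: "B \<star> x = x - (k \<star> x)" for x
    by (simp add: B_def)
  have swap_k: "cinner (k \<star> x) y = cinner x (k \<star> y)" for x y
    by (rule is_adjointD [OF adj_k])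
  have swap_B: "cinner (B \<star> x) y = cinner x (B \<star> y)" for x y
    by (rule is_adjointD [OF adj_B])
  txt \<open>\<open>B - B\<^sup>2 = B (1 - B) B + (1 - B) B (1 - B)\<close> is positive.\<close>
  have B_sq: "(norm (B \<star> x))\<^sup>2 \<le> (norm x)\<^sup>2 - Re (cinner x (k \<star> x))" for x
  proof -
    have "(norm x)\<^sup>2 - Re (cinner x (k \<star> x)) - (norm (B \<star> x))\<^sup>2
        = Re (cinner (B \<star> x) (k \<star> B \<star> x))
          + ((norm (k \<star> x))\<^sup>2 - Re (cinner (k \<star> x) (k \<star> k \<star> x)))"
      unfolding norm_sq B_apply
      by (simp add: cinner_diff_left cinner_diff_right bop_apply_diff_right swap_k)
    then show ?thesis
      using k_pos [of "B \<star> x"] k_le [of "k \<star> x"] by linarith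
  qed
  have B_mono: "(norm (B \<star> x))\<^sup>2 \<le> (norm x)\<^sup>2" for x
    using B_sq [of x] k_pos [of x] by linarith
  define C where "C = B * B"
  define a where "a = (\<lambda>x m. (norm ((B ^ m) \<star> x))\<^sup>2)"
  have C_pow: "C ^ m = B ^ (2 * m)" for m
    by (simp add: C_def power_mult power2_eq_square)
  have adj_pow: "is_adjoint (B ^ m) (B ^ m)" for m
  proof (induction m)
    case (Suc m)
    then show ?case
      using is_adjoint_times [OF adj_B Suc] by (simp add: power_commutes)
  qed simp
  have a_dec: "decseq (a x)" for x
    unfolding a_def by (rule decseq_SucI) (simp add: B_mono)
  have a_conv: "\<exists>l. a x \<longlonglongrightarrow> l" for x
    using decseq_convergent [OF a_dec [of x], of 0] by (auto simp: a_def)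
  \<comment> \<open>As \<open>B\<close> is self-adjoint, this inner product depends only on
    \<open>m + n\<close>, and for even powers of \<open>B\<close> it is a squared norm. Hence the
    decreasing sequence \<open>a x\<close> controls all distances in \<open>dist_sq\<close>.\<close>
  have cross: "Re (cinner ((C ^ m) \<star> x) ((C ^ n) \<star> x)) = a x (m + n)" for x m n
  proof -
    have "cinner ((C ^ m) \<star> x) ((C ^ n) \<star> x) = cinner x ((B ^ (2 * m) * B ^ (2 * n)) \<star> x)"
      unfolding C_pow by (simp add: is_adjointD [OF adj_pow])
    also have "B ^ (2 * m) * B ^ (2 * n) = B ^ (m + n) * B ^ (m + n)"
      by (simp add: power_add [symmetric] mult_2 add_ac)
    finally show ?thesis
      by (simp add: a_def norm_sq is_adjointD [OF adj_pow])
  qed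
  have dist_sq: "(norm ((C ^ m) \<star> x - (C ^ n) \<star> x))\<^sup>2 = a x (2 * m) + a x (2 * n) - 2 * a x (m + n)"
    for x m n
  proof -
    have "Re (cinner (u - v) (u - v)) = Re (cinner u u) + Re (cinner v v) - Re (cinner u v) - Re (cinner v u)"
      for u v :: 'a
      by (simp add: cinner_diff_left cinner_diff_right)
    then show ?thesis
      by (simp only: norm_sq cross) (simp only: mult_2 add.commute [of n m])
  qed
  have Cauchy: "Cauchy (\<lambda>m. (C ^ m) \<star> x)" for x
  proof (rule metric_CauchyI)
    fix e :: real assume "e > 0"
    obtain l where l: "a x \<longlonglongrightarrow> l"
      using a_conv by blast
    have e2: "e\<^sup>2 / 4 > 0"
      using \<open>e > 0\<close> by simp
    obtain K where K: "\<And>m. m \<ge> K \<Longrightarrow> \<bar>a x m - l\<bar> < e\<^sup>2 / 4"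
      using LIMSEQ_D [OF l e2] by auto
    have "dist ((C ^ m) \<star> x) ((C ^ n) \<star> x) < e" if "m \<ge> K" "n \<ge> K" for m n
    proof -
      have "(norm ((C ^ m) \<star> x - (C ^ n) \<star> x))\<^sup>2 < e\<^sup>2"
        unfolding dist_sq using K [of "2 * m"] K [of "2 * n"] K [of "m + n"] that by linarith
      then show ?thesis
        using \<open>e > 0\<close> unfolding dist_norm by (intro power_less_imp_less_base [of _ 2 e]) auto
    qed
    then show "\<exists>K. \<forall>m\<ge>K. \<forall>n\<ge>K. dist ((C ^ m) \<star> x) ((C ^ n) \<star> x) < e"
      by blast
  qed
  have norm_C: "norm ((C ^ m) \<star> x) \<le> norm x" for m x
  proof -
    have "a x (2 * m) \<le> a x 0"
      using a_dec by (simp add: decseq_def)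
    then have "(norm ((C ^ m) \<star> x))\<^sup>2 \<le> (norm x)\<^sup>2"
      by (simp add: a_def C_pow)
    then show ?thesis
      by (rule power2_le_imp_le) simp
  qed
  have bound: "norm l \<le> 1 * norm x" if "(\<lambda>m. (C ^ m) \<star> x) \<longlonglongrightarrow> l" for x l
    using LIMSEQ_le_const2 [OF tendsto_norm [OF that]] norm_C by auto
  have conv: "\<exists>l. (\<lambda>m. (C ^ m) \<star> x) \<longlonglongrightarrow> l" for x
    using Cauchy_convergent [OF Cauchy [of x]] by (simp add: convergent_def)
  obtain N where N: "\<And>x. (\<lambda>m. (C ^ m) \<star> x) \<longlonglongrightarrow> N \<star> x"
    using bop_limit [OF sequentially_bot conv bound] by auto
  have N_eqI: "N \<star> x = y" if "(\<lambda>m. (C ^ m) \<star> x) \<longlonglongrightarrow> y" for x y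
    by (rule LIMSEQ_unique [OF N that])
  have CN: "C \<star> N \<star> x = N \<star> x" for x
  proof -
    have "(\<lambda>m. C \<star> (C ^ m) \<star> x) \<longlonglongrightarrow> C \<star> N \<star> x"
      by (rule tendsto_bop_apply [OF N])
    then have "(\<lambda>m. (C ^ Suc m) \<star> x) \<longlonglongrightarrow> C \<star> N \<star> x"
      by simp
    then have "(\<lambda>m. (C ^ m) \<star> x) \<longlonglongrightarrow> C \<star> N \<star> x"
      by (rule LIMSEQ_imp_Suc)
    then show ?thesis
      by (rule N_eqI [symmetric])
  qed
  have CmN: "(C ^ m) \<star> N \<star> x = N \<star> x" for m x
    by (induction m) (simp_all add: CN)
  have NN: "N * N = N"
    by (rule bop_eqI) (simp add: N_eqI CmN)
  have adj_N: "is_adjoint N N"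
    unfolding is_adjoint_def
  proof (intro allI)
    fix x y
    have "(\<lambda>m. cinner ((C ^ m) \<star> x) y) \<longlonglongrightarrow> cinner (N \<star> x) y"
      by (intro tendsto_cinner N tendsto_const)
    moreover have "(\<lambda>m. cinner ((C ^ m) \<star> x) y) \<longlonglongrightarrow> cinner x (N \<star> y)"
      unfolding C_pow is_adjointD [OF adj_pow] unfolding C_pow [symmetric]
      by (intro tendsto_cinner N tendsto_const)
    ultimately show "cinner (N \<star> x) y = cinner x (N \<star> y)"
      by (rule LIMSEQ_unique)
  qed
  have "is_projection N"
    by (simp add: is_projection_def self_adjoint_def adj_N NN)
  moreover have "1 - N \<in> J"
  proof (rule strongly_closed_limit [OF J(2) sequentially_bot])
    have CU: "C \<in> U"
      unfolding C_def by (intro times_in BU)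
    \<comment> \<open>This is \<open>1 - B\<^sup>2 = (1 - B) (1 + B)\<close>. The powers of
      \<open>C\<close> need not lie in \<open>J\<close>, but their differences from 1 do, and so
      does the limit \<open>1 - N\<close>.\<close>
    have "1 - C = k + k * B"
      by (simp add: C_def B_def algebra_simps)
    then have C1: "1 - C \<in> J"
      by (simp add: Jplus Jtimes kJ BU)
    have "1 - C ^ m \<in> J" for m
    proof (induction m)
      case 0
      then show ?case using J(1) by (simp add: two_sided_ideal_def)
    next
      case (Suc m)
      have "1 - C ^ Suc m = (1 - C ^ m) * C + (1 - C)"
        by (simp add: algebra_simps power_commutes)
      then show ?case
        by (simp only: Jplus Jtimes Suc CU C1)
    qed
    then show "\<forall>\<^sub>F m in sequentially. 1 - C ^ m \<in> J"
      by simp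
    show "(\<lambda>m. (1 - C ^ m) \<star> x) \<longlonglongrightarrow> (1 - N) \<star> x" for x
      by (simp only: bop_apply_minus) (intro tendsto_diff tendsto_const N)
  qed
  moreover have "h * N = 0"
  proof (rule bop_eqI)
    fix x
    define y where "y = N \<star> x"
    have y: "B \<star> B \<star> y = y"
      using CN [of x] by (simp add: C_def y_def)
    \<comment> \<open>A vector fixed by \<open>B\<^sup>2\<close> loses no norm under
      \<open>B\<close>, so \<open>B_sq\<close> leaves no room for a positive value of the form of
      \<open>k\<close> at \<open>y\<close>.\<close>
    have "(norm y)\<^sup>2 \<le> (norm y)\<^sup>2 - Re (cinner y (k \<star> y))"
      using B_mono [of "B \<star> y"] B_sq [of y] unfolding y by linarith
    moreover have "(norm (B \<star> y))\<^sup>2 = (norm y)\<^sup>2 - 2 * Re (cinner y (k \<star> y)) + (norm (k \<star> y))\<^sup>2"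
      unfolding norm_sq B_apply
      by (simp add: cinner_diff_left cinner_diff_right swap_k)
    ultimately have "(norm (k \<star> y))\<^sup>2 \<le> 0"
      using B_mono [of y] k_pos [of y] by linarith
    then have "k \<star> y = 0"
      by simp
    moreover have "norm (k \<star> y) = norm (h \<star> y) / M"
      using M(1) by (simp add: k_apply norm_scaleC norm_divide)
    ultimately have "h \<star> y = 0"
      using M(1) by simp
    then show "(h * N) \<star> x = 0 \<star> x"
      by (simp add: y_def)
  qed
  ultimately show thesis
    using that by blast
qed


text \<open>With \<open>B\<close> the adjoint of \<open>A\<close>, the projection \<open>R\<close>
  is the complement of the kernel projection \<open>N\<close> of \<open>A * B\<close>. From
  \<open>A * B * N = 0\<close> it follows that \<open>N * A\<close> times its adjoint is zero, hence
  \<open>N * A = 0\<close>.\<close>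

lemma ideal_left_support:
  assumes J: "two_sided_ideal J" "strongly_closed J" and "A \<in> J"
  obtains R where "is_projection R" "R \<in> J" "R * A = A"
proof -
  have "A \<in> U"
    using assms by (auto simp: two_sided_ideal_def)
  then obtain B where B: "B \<in> U" "is_adjoint A B"
    using adjoint_in by blast
  have BA: "is_adjoint B A"
    by (rule is_adjoint_sym [OF B(2)])
  have h: "A * B \<in> J" "is_adjoint (A * B) (A * B)"
    using J(1) \<open>A \<in> J\<close> B is_adjoint_times [OF B(2) BA] by (auto simp: two_sided_ideal_def)
  have pos: "0 \<le> Re (cinner x ((A * B) \<star> x))" for x
    using is_adjointD [OF BA, of x "B \<star> x", symmetric] by (simp add: cinner_self)
  obtain N where N: "is_projection N" "1 - N \<in> J" "A * B * N = 0"
    using ideal_kernel_projection [OF J h pos] by blast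
  have "N * A = 0"
  proof -
    have adj: "is_adjoint (B * N) (N * A)"
      using is_projectionD(1) [OF N(1)] by (rule is_adjoint_times [OF BA])
    have "N * A * (B * N) = 0"
      using N(3) by (simp add: mult.assoc)
    then have "B * N = 0"
      by (rule adjoint_times_self_eq_0 [OF adj])
    then show ?thesis
      using is_adjoint_eq_0_iff [OF adj] by simp
  qed
  then have "(1 - N) * A = A"
    by (simp add: algebra_simps)
  moreover have "is_projection (1 - N)"
    using N(1) by (intro is_projection_minus) auto
  ultimately show thesis
    using that N(2) by blast
qed

text \<open>The form of \<open>R + S\<close> is a sum of two squared norms, so its kernel is the
  intersection of the two kernels, and the complement of that kernel dominates both
  projections.\<close>

lemma ideal_projections_directed:
  assumes J: "two_sided_ideal J" "strongly_closed J"
    and R: "is_projection R" "R \<in> J" and S: "is_projection S" "S \<in> J"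
  obtains T where "is_projection T" "T \<in> J" "T * R = R" "T * S = S"
proof -
  have h: "R + S \<in> J" "is_adjoint (R + S) (R + S)"
    using J(1) R S by (auto simp: two_sided_ideal_def intro: is_adjoint_plus is_projectionD(1))
  have split: "Re (cinner x ((R + S) \<star> x)) = (norm (R \<star> x))\<^sup>2 + (norm (S \<star> x))\<^sup>2" for x
    by (simp add: cinner_add_right cinner_projection R S)
  have pos: "0 \<le> Re (cinner x ((R + S) \<star> x))" for x
    unfolding split by simp
  obtain N where N: "is_projection N" "1 - N \<in> J" "(R + S) * N = 0"
    using ideal_kernel_projection [OF J h pos] by blast
  have zero: "(R + S) \<star> N \<star> x = 0" for x
    using N(3) by (metis bop_apply_times bop_apply_zero)
  have "(norm (R \<star> N \<star> x))\<^sup>2 + (norm (S \<star> N \<star> x))\<^sup>2 = 0" for x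
    using split [of "N \<star> x"] by (simp only: zero) simp
  then have RS: "R \<star> N \<star> x = 0 \<and> S \<star> N \<star> x = 0" for x
    by (simp add: sum_power2_eq_zero_iff)
  have "(1 - N) * P = P" if "is_projection P" "\<And>x. P \<star> N \<star> x = 0" for P
  proof -
    have "P * N = 0"
      by (rule bop_eqI) (simp add: that)
    moreover have "is_adjoint (P * N) (N * P)"
      by (intro is_adjoint_times is_projectionD that N)
    ultimately have "N * P = 0"
      using is_adjoint_eq_0_iff by blast
    then show ?thesis
      by (simp add: algebra_simps)
  qed
  moreover have "is_projection (1 - N)"
    using N(1) by (intro is_projection_minus) auto
  ultimately show thesis
    using that N(2) R S RS by blast
qed

text \<open>\<open>Q\<close> is the supremum of the projections in \<open>J\<close>, obtained as a
  strong limit so that it stays in \<open>J\<close>. It fixes every \<open>A\<close> because it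
  dominates a left support of \<open>A\<close>.\<close>

lemma ideal_unit:
  assumes J: "two_sided_ideal J" "strongly_closed J"
  obtains Q where "Q \<in> center U" "is_projection Q" "Q \<in> J" "\<And>A. A \<in> J \<Longrightarrow> Q * A = A"
proof -
  define \<P> where "\<P> = {R \<in> J. is_projection R}"
  \<comment> \<open>The filter of tails: a property holds eventually if it holds for all projections
    of \<open>J\<close> above some fixed one.\<close>
  define \<F> where "\<F> = (INF R\<in>\<P>. principal {S \<in> \<P>. S * R = R})"
  have "0 \<in> \<P>"
    using J(1) by (simp add: \<P>_def two_sided_ideal_def)
  have ev: "eventually Pr \<F> \<longleftrightarrow> (\<exists>R\<in>\<P>. \<forall>S\<in>\<P>. S * R = R \<longrightarrow> Pr S)" for Pr
  proof -
    have "\<exists>T\<in>\<P>. principal {S \<in> \<P>. S * T = T}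
        \<le> inf (principal {S \<in> \<P>. S * R = R}) (principal {S \<in> \<P>. S * R' = R'})"
      if R: "R \<in> \<P>" "R' \<in> \<P>" for R R'
    proof -
      obtain T where T: "is_projection T" "T \<in> J" "T * R = R" "T * R' = R'"
        using ideal_projections_directed [OF J, of R R'] R by (auto simp: \<P>_def)
      have "S * R = R" "S * R' = R'" if "S * T = T" for S
        using that T by (metis mult.assoc)+
      then have "{S \<in> \<P>. S * T = T} \<subseteq> {S \<in> \<P>. S * R = R} \<inter> {S \<in> \<P>. S * R' = R'}"
        by blast
      then show ?thesis
        using T by (intro bexI [of _ T]) (auto simp: \<P>_def)
    qed
    then show ?thesis
      unfolding \<F>_def using \<open>0 \<in> \<P>\<close>
      by (subst eventually_INF_base) (auto simp: eventually_principal)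
  qed
  have nontriv: "\<F> \<noteq> bot"
    unfolding trivial_limit_def ev using is_projectionD(2) by (auto simp: \<P>_def)
  have RD: "is_projection R" "R \<in> J" if "R \<in> \<P>" for R
    using that by (auto simp: \<P>_def)
  have conv: "\<exists>l. ((\<lambda>R. R \<star> x) \<longlongrightarrow> l) \<F>" for x
  proof (rule convergent_filter_Cauchy [OF nontriv])
    fix e :: real assume "e > 0"
    \<comment> \<open>For \<open>S\<close> above \<open>R\<close> the difference
      \<open>S - R\<close> is a projection, so the squared distance at \<open>x\<close> is a
      difference of squared norms; an \<open>R\<close> that nearly attains \<open>s\<close>
      therefore works.\<close>
    define s where "s = (SUP R\<in>\<P>. (norm (R \<star> x))\<^sup>2)"
    have bdd: "bdd_above ((\<lambda>R. (norm (R \<star> x))\<^sup>2) ` \<P>)"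
      by (rule bdd_aboveI2 [of _ _ "(norm x)\<^sup>2"]) (auto simp: norm_projection_le RD)
    have "s - e\<^sup>2 < s"
      using \<open>e > 0\<close> by simp
    then obtain R where R: "R \<in> \<P>" "s - e\<^sup>2 < (norm (R \<star> x))\<^sup>2"
      unfolding s_def using \<open>0 \<in> \<P>\<close> less_cSUP_iff [OF _ bdd] by blast
    have "dist (S \<star> x) (R \<star> x) < e" if S: "S \<in> \<P>" "S * R = R" for S
    proof -
      have adj: "is_adjoint (S * R) (R * S)"
        using S R by (intro is_adjoint_times is_projectionD RD)
      have "is_adjoint R R"
        using R by (intro is_projectionD RD)
      then have RS: "R * S = R"
        using adj is_adjoint_unique S(2) by metis
      have SR: "is_projection (S - R)"
        using S R RS by (intro is_projection_minus RD)
      have "complex_of_real ((norm ((S - R) \<star> x))\<^sup>2) = cinner x (S \<star> x) - cinner x (R \<star> x)"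
        unfolding cinner_projection [OF SR, symmetric] by (simp add: cinner_diff_right)
      also have "\<dots> = complex_of_real ((norm (S \<star> x))\<^sup>2 - (norm (R \<star> x))\<^sup>2)"
        using S R RD by (simp add: cinner_projection)
      finally have "(norm ((S - R) \<star> x))\<^sup>2 = (norm (S \<star> x))\<^sup>2 - (norm (R \<star> x))\<^sup>2"
        by (simp only: of_real_eq_iff)
      also have "\<dots> < e\<^sup>2"
        using R(2) cSUP_upper [OF S(1) bdd] by (simp add: s_def)
      finally show ?thesis
        using \<open>e > 0\<close> by (intro power_less_imp_less_base [of _ 2 e]) (auto simp: dist_norm)
    qed
    then show "\<exists>y. \<forall>\<^sub>F R in \<F>. dist (R \<star> x) y < e"
      unfolding ev using R(1) by blast
  qed
  have evP: "\<forall>\<^sub>F R in \<F>. R \<in> \<P>"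
    unfolding ev using \<open>0 \<in> \<P>\<close> by blast
  have bound: "norm l \<le> 1 * norm x" if "((\<lambda>R. R \<star> x) \<longlongrightarrow> l) \<F>" for x l
  proof (rule tendsto_upperbound [OF tendsto_norm [OF that] _ nontriv])
    show "\<forall>\<^sub>F R in \<F>. norm (R \<star> x) \<le> 1 * norm x"
      using evP by eventually_elim (simp add: norm_projection_le RD)
  qed
  obtain Q where Q: "\<And>x. ((\<lambda>R. R \<star> x) \<longlongrightarrow> Q \<star> x) \<F>"
    using bop_limit [OF nontriv conv bound] by auto
  have QR: "Q * R = R" if "R \<in> \<P>" for R
  proof (rule bop_eqI)
    fix x
    have "\<forall>\<^sub>F S in \<F>. S \<star> R \<star> x = R \<star> x"
      unfolding ev using that by (metis bop_apply_times)
    then have "((\<lambda>S. S \<star> R \<star> x) \<longlongrightarrow> R \<star> x) \<F>"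
      by (rule tendsto_eventually)
    then show "(Q * R) \<star> x = R \<star> x"
      using tendsto_unique [OF nontriv Q] by simp
  qed
  have "Q \<in> J"
    by (rule strongly_closed_limit [OF J(2) nontriv _ Q]) (use evP RD in \<open>auto elim: eventually_mono\<close>)
  have adj: "is_adjoint Q Q"
    unfolding is_adjoint_def
  proof (intro allI)
    fix x y
    have "\<forall>\<^sub>F R in \<F>. cinner (R \<star> x) y = cinner x (R \<star> y)"
      using evP by eventually_elim (simp add: RD is_projectionD(1) is_adjointD)
    moreover have "((\<lambda>R. cinner (R \<star> x) y) \<longlongrightarrow> cinner (Q \<star> x) y) \<F>"
      by (intro tendsto_cinner Q tendsto_const)
    ultimately have "((\<lambda>R. cinner x (R \<star> y)) \<longlongrightarrow> cinner (Q \<star> x) y) \<F>"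
      by (rule Lim_transform_eventually [rotated])
    moreover have "((\<lambda>R. cinner x (R \<star> y)) \<longlongrightarrow> cinner x (Q \<star> y)) \<F>"
      by (intro tendsto_cinner Q tendsto_const)
    ultimately show "cinner (Q \<star> x) y = cinner x (Q \<star> y)"
      by (rule tendsto_unique [OF nontriv])
  qed
  have QA: "Q * A = A" if "A \<in> J" for A
  proof -
    obtain R where "is_projection R" "R \<in> J" "R * A = A"
      using ideal_left_support [OF J \<open>A \<in> J\<close>] by blast
    then show ?thesis
      using QR [of R] by (metis (no_types, lifting) \<P>_def mem_Collect_eq mult.assoc)
  qed
  have "Q * X = X * Q" if X: "X \<in> U" for X
  proof -
    obtain Y where Y: "Y \<in> U" "is_adjoint X Y"
      using adjoint_in X by blast
    \<comment> \<open>Both \<open>X * Q\<close> and \<open>Y * Q\<close> lie in the ideal, so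
      \<open>Q\<close> fixes them from the left. The adjoint of the second equation reads
      \<open>Q * X * Q = Q * X\<close>.\<close>
    have "Q * (X * Q) = X * Q" "Q * (Y * Q) = Y * Q"
      using J(1) \<open>Q \<in> J\<close> X Y(1) by (auto simp: two_sided_ideal_def intro!: QA)
    moreover have "is_adjoint (Q * X) (Y * Q)" "is_adjoint (Q * X * Q) (Q * (Y * Q))"
      by (intro is_adjoint_times adj Y)+
    ultimately show ?thesis
      using is_adjoint_unique is_adjoint_sym by (metis mult.assoc)
  qed
  then have "Q \<in> center U"
    using J(1) \<open>Q \<in> J\<close> by (auto simp: center_def two_sided_ideal_def)
  moreover have "is_projection Q"
    using QA [OF \<open>Q \<in> J\<close>] adj by (simp add: is_projection_def self_adjoint_def)
  ultimately show thesis
    using that QA \<open>Q \<in> J\<close> by blast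
qed

section \<open>Annihilators, central carriers and cores\<close>

lemma annihilator_ideal:
  assumes "P \<in> U"
  shows "two_sided_ideal {A \<in> U. \<forall>X\<in>U. A * X * P = 0}" (is "two_sided_ideal ?J")
    and "strongly_closed {A \<in> U. \<forall>X\<in>U. A * X * P = 0}"
proof -
  have "A * B * X * P = 0" if "A \<in> ?J" "B \<in> U" "X \<in> U" for A B X
    using that times_in [of B X] mult.assoc [of A B X] by simp
  moreover have "B * A * X * P = 0" if "A \<in> ?J" "B \<in> U" "X \<in> U" for A B X
    using that by (simp add: mult.assoc)
  ultimately show "two_sided_ideal ?J"
    unfolding two_sided_ideal_def
    by (auto simp: zero_in plus_in times_in distrib_right)
  show "strongly_closed ?J"
    unfolding strongly_closed_def
  proof (intro allI impI)
    fix T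
    assume approx: "\<forall>X e. finite X \<longrightarrow> e > 0 \<longrightarrow> (\<exists>A\<in>?J. \<forall>x\<in>X. norm ((A - T) \<star> x) < e)"
    then have "\<forall>X e. finite X \<longrightarrow> e > 0 \<longrightarrow> (\<exists>A\<in>U. \<forall>x\<in>X. norm ((A - T) \<star> x) < e)"
      by blast
    then have "T \<in> U"
      using strongly_closed unfolding strongly_closed_def by blast
    moreover have "T * X * P = 0" if "X \<in> U" for X
    proof (rule bop_eqI)
      fix x
      have "norm (T \<star> X \<star> P \<star> x) < e" if "e > 0" for e
      proof -
        obtain A where A: "A \<in> ?J" "norm ((A - T) \<star> X \<star> P \<star> x) < e"
          using approx [rule_format, of "{X \<star> P \<star> x}" e] \<open>e > 0\<close> by auto
        have "A \<star> X \<star> P \<star> x = 0"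
          using A(1) \<open>X \<in> U\<close> by (metis (mono_tags, lifting) bop_apply_times bop_apply_zero mem_Collect_eq)
        then show ?thesis
          using A(2) by simp
      qed
      then have "norm (T \<star> X \<star> P \<star> x) \<le> 0"
        using less_irrefl not_le by blast
      then show "(T * X * P) \<star> x = 0 \<star> x"
        by simp
    qed
    ultimately show "T \<in> ?J"
      by blast
  qed
qed

text \<open>\<open>Q\<close> is the unit of the annihilator ideal of \<open>U P\<close>: it lies in
  the ideal, hence kills \<open>P\<close>, and it fixes the member \<open>T\<close>.\<close>

lemma central_support:
  assumes "T \<in> U" "P \<in> U" "\<And>X. X \<in> U \<Longrightarrow> T * X * P = 0"
  obtains Q where "Q \<in> center U" "is_projection Q" "Q * P = 0" "Q * T = T"
proof -
  obtain Q where Q: "Q \<in> center U" "is_projection Q" "Q \<in> {A \<in> U. \<forall>X\<in>U. A * X * P = 0}"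
      "\<And>A. A \<in> {A \<in> U. \<forall>X\<in>U. A * X * P = 0} \<Longrightarrow> Q * A = A"
    using ideal_unit [OF annihilator_ideal [OF assms(2)]] by blast
  have "Q * 1 * P = 0"
    using Q(3) one_in by blast
  then show thesis
    using that Q(1,2) Q(4) [of T] assms(1,3) by simp
qed

text \<open>Positivity of \<open>R - Q\<close> is tested at \<open>y = (1 - R) Q x\<close>. As
  \<open>R\<close> kills \<open>y\<close>, so must \<open>Q\<close>, which makes \<open>y\<close>
  orthogonal to both of its terms.\<close>

lemma projection_le_imp_times:
  assumes "is_projection Q" "is_projection R" "Q \<le>\<^sub>o\<^sub>p R"
  shows "R * Q = Q"
proof (rule bop_eqI)
  fix x
  define y where "y = (Q \<star> x) - (R \<star> Q \<star> x)"
  have Ry: "R \<star> y = 0"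
    by (simp add: y_def bop_apply_diff_right is_projectionD(3) [OF assms(2)])
  have "cinner y ((R - Q) \<star> y) = - complex_of_real ((norm (Q \<star> y))\<^sup>2)"
    by (simp add: Ry cinner_minus_right cinner_projection [OF assms(1)])
  then have "- complex_of_real ((norm (Q \<star> y))\<^sup>2) \<in> \<real>\<^sub>\<ge>\<^sub>0"
    using assms(3) unfolding bop_le_def by metis
  then have "Q \<star> y = 0"
    by (simp add: complex_nonneg_Reals_iff)
  then have "cinner (Q \<star> x) y = 0"
    using is_adjointD [OF is_projectionD(1) [OF assms(1)], of x y] by simp
  moreover have "cinner (R \<star> Q \<star> x) y = 0"
    using is_adjointD [OF is_projectionD(1) [OF assms(2)], of "Q \<star> x" y] Ry by simp
  ultimately have "cinner y y = 0"
    by (simp add: y_def cinner_diff_left)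
  then show "(R * Q) \<star> x = Q \<star> x"
    by (simp add: cinner_self y_def)
qed

text \<open>The complement of the central support \<open>Q\<close> of \<open>T\<close> fixes
  \<open>P\<close>, so by minimality it dominates the central carrier. Then
  \<open>Q * E = 0\<close>, although both factors fix \<open>T\<close>.\<close>

lemma carrier_faithful:
  assumes E: "is_central_carrier U P E" and "P \<in> U" and T: "T \<in> U" "T * E = T"
    and ann: "\<And>X. X \<in> U \<Longrightarrow> T * X * P = 0"
  shows "T = 0"
proof -
  obtain Q where Q: "Q \<in> center U" "is_projection Q" "Q * P = 0" "Q * T = T"
    using central_support [OF T(1) \<open>P \<in> U\<close> ann] by blast
  have R: "1 - Q \<in> center U" "is_projection (1 - Q)"
    using Q(1,2) by (auto simp: center_def minus_in one_in algebra_simps intro!: is_projection_minus)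
  have "(1 - Q) * P = P"
    using Q(3) by (simp add: algebra_simps)
  then have "E \<le>\<^sub>o\<^sub>p 1 - Q" and "is_projection E"
    using E R by (auto simp: is_central_carrier_def)
  then have "(1 - Q) * E = E"
    using R(2) projection_le_imp_times by blast
  then have "Q * E = 0"
    by (simp add: algebra_simps)
  moreover have "T = T * (Q * E)"
    using Q(4) T center_commute [OF Q(1) T(1)] by (metis mult.assoc)
  ultimately show ?thesis
    by simp
qed

text \<open>If the central support \<open>Q\<close> kills \<open>E - P\<close>, then
  \<open>Q * E = Q * P\<close> is a central projection below \<open>P\<close>, which core-freeness
  forces to be zero.\<close>

lemma core_free_faithful:
  assumes E: "is_central_carrier U P E" and "P \<in> U" "is_projection P" "core_free U P"
    and T: "T \<in> U" "T * E = T"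
    and ann: "\<And>X. X \<in> U \<Longrightarrow> T * X * (E - P) = 0"
  shows "T = 0"
proof -
  have EU: "E \<in> center U" "E * P = P" "is_projection E"
    using E by (auto simp: is_central_carrier_def)
  have "E - P \<in> U"
    using center_in [OF EU(1)] \<open>P \<in> U\<close> by (rule minus_in)
  then obtain Q where Q: "Q \<in> center U" "is_projection Q" "Q * (E - P) = 0" "Q * T = T"
    using central_support [OF T(1) _ ann] by blast
  define R where "R = Q * E"
  have comm: "Q * E = E * Q"
    using Q(1) EU(1) center_in center_commute by blast
  have R: "R \<in> center U" "is_projection R"
  proof -
    show "is_projection R"
      unfolding R_def by (intro is_projection_times Q EU comm)
    have "R * A = A * R" if "A \<in> U" for A
      unfolding R_def using center_commute [OF Q(1) that] center_commute [OF EU(1) that]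
      by (metis mult.assoc)
    then show "R \<in> center U"
      unfolding center_def R_def using Q(1) EU(1) times_in center_in by blast
  qed
  have "R = Q * P"
    using Q(3) by (simp add: R_def algebra_simps)
  then have RP: "R * P = R" "P * R = R"
    using is_projectionD(2) [OF \<open>is_projection P\<close>] center_commute [OF Q(1) \<open>P \<in> U\<close>]
    by (metis mult.assoc)+
  have PR: "is_projection (P - R)"
    by (intro is_projection_minus RP R assms)
  have "R \<le>\<^sub>o\<^sub>p P"
    unfolding bop_le_def cinner_projection [OF PR] by (simp del: of_real_power)
  moreover have "self_adjoint R"
    using R(2) by (simp add: is_projection_def)
  ultimately have "R \<le>\<^sub>o\<^sub>p 0"
    using \<open>core_free U P\<close> R(1) by (simp add: core_free_def is_core_def)
  then have "R = 0"
    using projection_le_imp_times [OF R(2) is_projection_zero] by simp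
  moreover have "T = T * R"
    using Q(4) T center_commute [OF Q(1) T(1)] unfolding R_def by (metis mult.assoc)
  ultimately show ?thesis
    by simp
qed

text \<open>Passing to adjoints exchanges left and right annihilators.\<close>

lemma faithful_left:
  assumes faithful: "\<And>T. T \<in> U \<Longrightarrow> T * E = T \<Longrightarrow> (\<And>X. X \<in> U \<Longrightarrow> T * X * P = 0) \<Longrightarrow> T = 0"
    and "is_projection P" "is_projection E" "E \<in> center U"
    and T: "T \<in> U" "T * E = T" and ann: "\<And>X. X \<in> U \<Longrightarrow> P * X * T = 0"
  shows "T = 0"
proof -
  obtain S where S: "S \<in> U" "is_adjoint T S"
    using adjoint_in T(1) by blast
  have "E * T = T"
    using center_commute [OF assms(4) T(1)] T(2) by simp
  then have "is_adjoint T (S * E)"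
    using is_adjoint_times [OF is_projectionD(1) [OF assms(3)] S(2)] by simp
  then have "S * E = S"
    using S(2) is_adjoint_unique by blast
  moreover have "S * X * P = 0" if X: "X \<in> U" for X
  proof -
    obtain Y where Y: "Y \<in> U" "is_adjoint X Y"
      using adjoint_in X by blast
    have "is_adjoint (S * X * P) (P * (Y * T))"
      by (intro is_adjoint_times is_adjoint_sym [OF S(2)] Y is_projectionD assms)
    then show ?thesis
      using ann [OF Y(1)] by (simp add: is_adjoint_eq_0_iff mult.assoc)
  qed
  ultimately have "S = 0"
    using faithful S(1) by blast
  then show ?thesis
    using is_adjoint_eq_0_iff [OF S(2)] by blast
qed

text \<open>A central element commutes with its adjoint \<open>B\<close>, so \<open>B * C\<close> is
  a self-adjoint element of square zero.\<close>

lemma central_square_zero: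
  assumes "C \<in> center U" "C * C = 0"
  shows "C = 0"
proof -
  obtain B where B: "B \<in> U" "is_adjoint C B"
    using adjoint_in center_in assms(1) by blast
  have CB: "C * B = B * C"
    using center_commute [OF assms(1) B(1)] .
  have adj: "is_adjoint (B * C) (B * C)"
    by (intro is_adjoint_times B is_adjoint_sym [OF B(2)])
  have "B * C * (B * C) = B * B * (C * C)"
    using CB by (metis mult.assoc)
  then have "B * C = 0"
    using adjoint_times_self_eq_0 [OF adj] assms(2) by simp
  then show ?thesis
    by (rule adjoint_times_self_eq_0 [OF B(2)])
qed

section \<open>The center of a corner\<close>

text \<open>The maps \<open>c \<mapsto> A\<^sub>1 c B\<^sub>1 + \<dots> + A\<^sub>k c B\<^sub>k\<close>.\<close>

inductive_set sandwich :: "('a bop \<Rightarrow> 'a bop) set" where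
  zero: "(\<lambda>c. 0) \<in> sandwich"
| step: "\<lbrakk>A \<in> U; B \<in> U; \<Phi> \<in> sandwich\<rbrakk> \<Longrightarrow> (\<lambda>c. A * c * B + \<Phi> c) \<in> sandwich"

lemma sandwich_plus:
  assumes "\<Phi> \<in> sandwich" "\<Psi> \<in> sandwich"
  shows "(\<lambda>c. \<Phi> c + \<Psi> c) \<in> sandwich"
  using assms(1)
proof induction
  case (step A B \<Phi>)
  then show ?case
    using sandwich.step [of A B "\<lambda>c. \<Phi> c + \<Psi> c"] by (simp add: add.assoc)
qed (simp add: assms(2))

lemma sandwich_left:
  assumes "\<Phi> \<in> sandwich" "X \<in> U"
  shows "(\<lambda>c. X * \<Phi> c) \<in> sandwich"
  using assms(1)
proof induction
  case (step A B \<Phi>)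
  then show ?case
    using sandwich.step [of "X * A" B "\<lambda>c. X * \<Phi> c"] assms(2) times_in
    by (simp add: distrib_left mult.assoc)
qed (simp add: sandwich.zero)

lemma sandwich_right:
  assumes "\<Phi> \<in> sandwich" "X \<in> U"
  shows "(\<lambda>c. \<Phi> c * X) \<in> sandwich"
  using assms(1)
proof induction
  case (step A B \<Phi>)
  then show ?case
    using sandwich.step [of A "B * X" "\<lambda>c. \<Phi> c * X"] assms(2) times_in
    by (simp add: distrib_right mult.assoc)
qed (simp add: sandwich.zero)

lemma sandwich_minus:
  assumes "\<Phi> \<in> sandwich" "\<Psi> \<in> sandwich"
  shows "(\<lambda>c. \<Phi> c - \<Psi> c) \<in> sandwich"
  using sandwich_plus [OF assms(1) sandwich_left [OF assms(2) uminus_in [OF one_in]]]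
  by (metis (no_types, lifting) ext add_uminus_conv_diff mult_1 mult_minus_left)

lemma sandwich_in: "\<Phi> \<in> sandwich \<Longrightarrow> c \<in> U \<Longrightarrow> \<Phi> c \<in> U"
  by (induction rule: sandwich.induct) (auto intro: zero_in plus_in times_in)

text \<open>The constant depends on \<open>\<Phi>\<close>, which is harmless:
  \<open>sandwich_norm_le\<close> applies it to powers with exponent \<open>2 ^ k\<close> and takes
  roots.\<close>

lemma sandwich_bound:
  assumes "\<Phi> \<in> sandwich"
  obtains C where "C \<ge> 0"
    "\<And>c M y. M \<ge> 0 \<Longrightarrow> (\<And>x. norm (c \<star> x) \<le> M * norm x) \<Longrightarrow> norm (\<Phi> c \<star> y) \<le> C * M * norm y"
  using assms
proof (induction arbitrary: thesis)
  case zero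
  then show ?case by force
next
  case (step A B \<Phi>)
  obtain C where C: "C \<ge> 0"
    "\<And>c M y. M \<ge> 0 \<Longrightarrow> (\<And>x. norm (c \<star> x) \<le> M * norm x) \<Longrightarrow> norm (\<Phi> c \<star> y) \<le> C * M * norm y"
    using step.IH by blast
  obtain a where a: "a > 0" "\<And>x. norm (A \<star> x) \<le> a * norm x"
    using bop_bound [of A] by blast
  obtain b where b: "b > 0" "\<And>x. norm (B \<star> x) \<le> b * norm x"
    using bop_bound [of B] by blast
  show ?case
  proof (rule step.prems)
    show "a * b + C \<ge> 0"
      using a b C by simp
    fix c :: "'a bop" and y :: 'a and M :: real
    assume "M \<ge> 0" and M: "\<And>x. norm (c \<star> x) \<le> M * norm x"
    have "norm (A \<star> c \<star> B \<star> y) \<le> a * norm (c \<star> B \<star> y)"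
      by (rule a)
    also have "\<dots> \<le> a * (M * norm (B \<star> y))"
      using M a by (intro mult_left_mono) auto
    also have "\<dots> \<le> a * (M * (b * norm y))"
      using b a \<open>M \<ge> 0\<close> by (intro mult_left_mono) auto
    finally have "norm (A \<star> c \<star> B \<star> y) \<le> a * b * M * norm y"
      by (simp add: mult_ac)
    moreover have "norm (\<Phi> c \<star> y) \<le> C * M * norm y"
      using C(2) \<open>M \<ge> 0\<close> M by blast
    ultimately have "norm ((A \<star> c \<star> B \<star> y) + (\<Phi> c \<star> y)) \<le> a * b * M * norm y + C * M * norm y"
      by (rule norm_triangle_mono)
    then show "norm ((A * c * B + \<Phi> c) \<star> y) \<le> (a * b + C) * M * norm y"
      by (simp add: algebra_simps)
  qed
qed

section \<open>Elements of the center of a corner\<close>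

definition corner_center :: "'a bop \<Rightarrow> 'a bop set" where
  "corner_center f = {c \<in> U. f * c = c \<and> c * f = c \<and> (\<forall>A\<in>U. c * (f * A * f) = f * A * f * c)}"

lemma corner_centerD:
  assumes "c \<in> corner_center f"
  shows "c \<in> U" "f * c = c" "c * f = c"
    and "\<And>A. A \<in> U \<Longrightarrow> c * A * f = f * A * c"
proof -
  show c: "c \<in> U" "f * c = c" "c * f = c"
    using assms by (auto simp: corner_center_def)
  fix A assume "A \<in> U"
  then have "c * (f * A * f) = f * A * f * c"
    using assms by (auto simp: corner_center_def)
  then show "c * A * f = f * A * c"
    using c by (metis mult.assoc)
qed

lemma corner_center_times:
  assumes c: "c \<in> corner_center f" and d: "d \<in> corner_center f"
  shows "c * d \<in> corner_center f"
proof -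
  have "c * d * (f * A * f) = f * A * f * (c * d)" if A: "A \<in> U" for A
  proof -
    have "c * (f * A * f) = f * A * f * c" "d * (f * A * f) = f * A * f * d"
      using c d A by (auto simp: corner_center_def)
    then show ?thesis
      by (metis mult.assoc)
  qed
  moreover have "f * (c * d) = c * d" "c * d * f = c * d"
    using corner_centerD(2) [OF c] corner_centerD(3) [OF d] by (metis mult.assoc)+
  moreover have "c * d \<in> U"
    by (rule times_in [OF corner_centerD(1) [OF c] corner_centerD(1) [OF d]])
  ultimately show ?thesis
    unfolding corner_center_def by blast
qed

lemma corner_center_adjoint:
  assumes c: "c \<in> corner_center f" and "is_projection f" and c': "c' \<in> U" "is_adjoint c c'"
  shows "c' \<in> corner_center f"
proof -
  have f: "is_adjoint f f"
    by (rule is_projectionD) fact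
  have "is_adjoint (f * c) (c' * f)" "is_adjoint (c * f) (f * c')"
    by (intro is_adjoint_times f c')+
  then have cf: "c' * f = c'" "f * c' = c'"
    using corner_centerD(2,3) [OF c] c'(2) is_adjoint_unique by metis+
  have "c' * (f * A * f) = f * A * f * c'" if A: "A \<in> U" for A
  proof -
    obtain B where B: "B \<in> U" "is_adjoint A B"
      using adjoint_in A by blast
    have B': "is_adjoint B A"
      by (rule is_adjoint_sym [OF B(2)])
    have "is_adjoint (c * (f * B * f)) (f * (A * f) * c')"
      "is_adjoint (f * B * f * c) (c' * (f * (A * f)))"
      by (intro is_adjoint_times f c' B')+
    moreover have "c * (f * B * f) = f * B * f * c"
      using c B(1) by (auto simp: corner_center_def)
    ultimately show ?thesis
      using is_adjoint_unique by (metis mult.assoc)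
  qed
  then show ?thesis
    using cf c' by (simp add: corner_center_def)
qed

text \<open>Between two single terms stands the factor \<open>A1 * A'\<close>, and
  \<open>corner_centerD(4)\<close> moves the adjoint \<open>c'\<close> across it until it meets
  \<open>d\<close>. The inner product thus sees \<open>c\<close> and \<open>d\<close> only through
  \<open>c' * d\<close>.\<close>

lemma sandwich_cinner:
  assumes f: "is_projection f" "f \<in> U" and c: "c \<in> corner_center f" "is_adjoint c c'"
    and c': "c' \<in> corner_center f" and d: "d \<in> corner_center f"
    and "\<Phi> \<in> sandwich" "\<Psi> \<in> sandwich"
  shows "cinner (\<Phi> c \<star> y) (\<Psi> d \<star> z) = cinner (\<Phi> f \<star> y) (\<Psi> (c' * d) \<star> z)"
  using \<open>\<Phi> \<in> sandwich\<close>
proof induction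
  case (step A B \<Phi>)
  have "cinner ((A * c * B) \<star> y) (\<Psi> d \<star> z) = cinner ((A * f * B) \<star> y) (\<Psi> (c' * d) \<star> z)"
    using \<open>\<Psi> \<in> sandwich\<close>
  proof induction
    case (step A' B' \<Psi>)
    obtain A1 where A1: "A1 \<in> U" "is_adjoint A A1"
      using adjoint_in \<open>A \<in> U\<close> by blast
    have AA: "A1 * A' \<in> U"
      using A1 step by (simp add: times_in)
    have "f * (A1 * A') * (c' * d) = f * (A1 * A') * c' * d"
      by (simp add: mult.assoc)
    also have "\<dots> = c' * (A1 * A') * f * d"
      by (simp only: corner_centerD(4) [OF c' AA])
    also have "\<dots> = c' * (A1 * A') * d"
      by (simp add: corner_centerD(2) [OF d] mult.assoc)
    finally have eq: "f * (A1 * A') * (c' * d) * B' = c' * (A1 * A') * d * B'"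
      by simp
    have "cinner ((A * c * B) \<star> y) ((A' * d * B') \<star> z) = cinner (B \<star> y) ((c' * (A1 * A') * d * B') \<star> z)"
      by (simp add: is_adjointD [OF A1(2)] is_adjointD [OF c(2)])
    moreover have "cinner ((A * f * B) \<star> y) ((A' * (c' * d) * B') \<star> z)
        = cinner (B \<star> y) ((f * (A1 * A') * (c' * d) * B') \<star> z)"
      by (simp add: is_adjointD [OF A1(2)] is_adjointD [OF is_projectionD(1) [OF f(1)]])
    ultimately have "cinner ((A * c * B) \<star> y) ((A' * d * B') \<star> z)
        = cinner ((A * f * B) \<star> y) ((A' * (c' * d) * B') \<star> z)"
      by (simp only: eq)
    then show ?case
      using step.IH by (simp only: bop_apply_plus cinner_add_right)
  qed simp
  then show ?case
    using step.IH by (simp only: bop_apply_plus cinner_add_left)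
qed simp

text \<open>The constant \<open>C\<close> disappears under roots of growing order: for
  \<open>r > B\<close> the powers of \<open>r / B\<close> would be unbounded.\<close>

lemma power_bound_imp_le:
  fixes r B C :: real
  assumes "r \<ge> 0" "B > 0" "\<And>k. r ^ (2 ^ k) \<le> C * B ^ (2 ^ k)"
  shows "r \<le> B"
proof (rule ccontr)
  assume "\<not> r \<le> B"
  then have "r / B > 1"
    using \<open>B > 0\<close> by simp
  then obtain k where k: "C < (r / B) ^ k"
    using real_arch_pow by blast
  have "(r / B) ^ k \<le> (r / B) ^ (2 ^ k)"
    using \<open>r / B > 1\<close> by (intro power_increasing) auto
  also have "\<dots> \<le> C"
    using assms(3) [of k] \<open>B > 0\<close> by (simp add: power_divide divide_le_eq)
  finally show False
    using k by simp
qed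

text \<open>With \<open>g = c\<^sup>* c\<close>, repeated use of the Cauchy-Schwarz inequality bounds
  \<open>\<parallel>\<Phi> g y\<parallel>\<close> by \<open>\<parallel>\<Phi> f y\<parallel>\<^bsup>1 - 2\<^sup>-\<^sup>k\<^esup> \<parallel>\<Phi> (g\<^bsup>2\<^sup>k\<^esup>) y\<parallel>\<^bsup>2\<^sup>-\<^sup>k\<^esup>\<close>.\<close>

lemma sandwich_norm_le:
  assumes f: "is_projection f" "f \<in> U" and c: "c \<in> corner_center f"
  obtains b where "b > 0"
    "\<And>\<Phi> y. \<Phi> \<in> sandwich \<Longrightarrow> norm (\<Phi> c \<star> y) \<le> b * norm (\<Phi> f \<star> y)"
proof -
  obtain c' where c': "c' \<in> U" "is_adjoint c c'"
    using adjoint_in corner_centerD(1) [OF c] by blast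
  have c'_center: "c' \<in> corner_center f"
    by (rule corner_center_adjoint [OF c f(1) c'])
  define g where "g = c' * c"
  have g: "g \<in> corner_center f"
    unfolding g_def by (intro corner_center_times c c'_center)
  have adj_g: "is_adjoint g g"
    unfolding g_def by (intro is_adjoint_times c' is_adjoint_sym [OF c'(2)])
  obtain B where B: "B > 0" "\<And>x. norm (g \<star> x) \<le> B * norm x"
    using bop_bound [of g] by blast
  have pow: "g ^ (2 ^ k) \<in> corner_center f \<and> is_adjoint (g ^ (2 ^ k)) (g ^ (2 ^ k))" for k
  proof (induction k)
    case (Suc k)
    then show ?case
      using corner_center_times is_adjoint_times by (auto simp: mult_2 power_add)
  qed (simp add: g adj_g)
  have pow_bound: "norm ((g ^ m) \<star> x) \<le> B ^ m * norm x" for m x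
  proof (induction m)
    case (Suc m)
    have "norm ((g ^ Suc m) \<star> x) \<le> B * norm ((g ^ m) \<star> x)"
      using B(2) by simp
    also have "\<dots> \<le> B * (B ^ m * norm x)"
      using Suc B(1) by (intro mult_left_mono) auto
    finally show ?case
      by (simp add: mult_ac)
  qed simp
  \<comment> \<open>The constant \<open>sqrt B\<close> arises from \<open>c_le\<close> and
    \<open>t 0 \<le> B * u\<close>. It depends neither on \<open>\<Phi>\<close> nor on
    \<open>y\<close>, which is what makes the net in \<open>corner_center_extends\<close>
    converge.\<close>
  have main: "norm (\<Phi> c \<star> y) \<le> sqrt B * norm (\<Phi> f \<star> y)" if \<Phi>: "\<Phi> \<in> sandwich" for \<Phi> y
  proof -
    define u where "u = norm (\<Phi> f \<star> y)"
    define t where "t = (\<lambda>k. norm (\<Phi> (g ^ (2 ^ k)) \<star> y))"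
    have sq_le: "(norm (\<Phi> h \<star> y))\<^sup>2 \<le> u * norm (\<Phi> (h' * h) \<star> y)"
      if "h \<in> corner_center f" "is_adjoint h h'" "h' \<in> corner_center f" for h h'
    proof -
      have "complex_of_real ((norm (\<Phi> h \<star> y))\<^sup>2) = cinner (\<Phi> f \<star> y) (\<Phi> (h' * h) \<star> y)"
        using sandwich_cinner [OF f that that(1) \<Phi> \<Phi>] by (simp only: cinner_self [symmetric])
      then have "(norm (\<Phi> h \<star> y))\<^sup>2 = cmod (cinner (\<Phi> f \<star> y) (\<Phi> (h' * h) \<star> y))"
        by (metis abs_of_nonneg norm_of_real zero_le_power2)
      then show ?thesis
        using norm_cinner_le unfolding u_def by metis
    qed
    have c_le: "(norm (\<Phi> c \<star> y))\<^sup>2 \<le> u * t 0"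
      using sq_le [OF c c'(2) c'_center] by (simp add: t_def g_def)
    have t_le: "(t k)\<^sup>2 \<le> u * t (Suc k)" for k
      using sq_le [of "g ^ 2 ^ k" "g ^ 2 ^ k"] pow [of k] by (simp add: t_def mult_2 power_add)
    have "(norm (\<Phi> c \<star> y))\<^sup>2 \<le> B * u\<^sup>2"
    proof (cases "u = 0")
      case False
      then have "u > 0" by (simp add: u_def)
      obtain C where C: "C \<ge> 0" "\<And>c M y. M \<ge> 0 \<Longrightarrow> (\<And>x. norm (c \<star> x) \<le> M * norm x)
          \<Longrightarrow> norm (\<Phi> c \<star> y) \<le> C * M * norm y"
        using sandwich_bound [OF \<Phi>] by blast
      have step: "(t 0 / u) ^ (2 ^ k) \<le> t k / u" for k
      proof (induction k)
        case (Suc k)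
        have "(t 0 / u) ^ (2 ^ Suc k) = ((t 0 / u) ^ (2 ^ k))\<^sup>2"
          by (simp add: power_mult [symmetric] mult.commute)
        also have "\<dots> \<le> (t k / u)\<^sup>2"
          using Suc \<open>u > 0\<close> by (intro power_mono) (auto simp: t_def)
        also have "\<dots> = (t k)\<^sup>2 / u\<^sup>2"
          by (rule power_divide)
        also have "\<dots> \<le> u * t (Suc k) / u\<^sup>2"
          using t_le by (intro divide_right_mono) auto
        also have "\<dots> = t (Suc k) / u"
          using \<open>u > 0\<close> by (simp add: power2_eq_square)
        finally show ?case .
      qed simp
      \<comment> \<open>The crude bound for the power \<open>g ^ (2 ^ k)\<close> grows like
        \<open>B ^ (2 ^ k)\<close> times a constant independent of \<open>k\<close>, so
        \<open>step\<close> gives the sharp bound in the limit.\<close>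
      have "t 0 / u \<le> B"
      proof (rule power_bound_imp_le [OF _ B(1)])
        show "t 0 / u \<ge> 0"
          using \<open>u > 0\<close> by (simp add: t_def)
        show "(t 0 / u) ^ (2 ^ k) \<le> (C * norm y / u) * B ^ (2 ^ k)" for k
        proof -
          have "t k \<le> C * B ^ (2 ^ k) * norm y"
            unfolding t_def using B(1) pow_bound by (intro C(2)) auto
          then have "t k / u \<le> C * B ^ (2 ^ k) * norm y / u"
            using \<open>u > 0\<close> by (intro divide_right_mono) auto
          then show ?thesis
            using step [of k] by (simp add: mult_ac)
        qed
      qed
      then have "t 0 \<le> B * u"
        using \<open>u > 0\<close> by (simp add: divide_le_eq)
      then have "u * t 0 \<le> u * (B * u)"
        using \<open>u > 0\<close> by (intro mult_left_mono) auto
      then show ?thesis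
        using c_le by (simp add: power2_eq_square mult_ac)
    qed (use c_le in simp)
    then have "(norm (\<Phi> c \<star> y))\<^sup>2 \<le> (sqrt B * u)\<^sup>2"
      using B(1) by (simp add: power_mult_distrib)
    then have "norm (\<Phi> c \<star> y) \<le> sqrt B * u"
      by (rule power2_le_imp_le) (use B(1) in \<open>simp add: u_def\<close>)
    then show ?thesis
      by (simp add: u_def)
  qed
  show thesis
    using that [of "sqrt B"] B(1) main by simp
qed

text \<open>\<open>J\<close> is the strong closure of the ideal generated by \<open>f\<close>, whose
  elements are the values \<open>\<Phi> f\<close>. Right multiplication by \<open>A\<close> moves
  the test vectors by \<open>A\<close>; left multiplication costs a bound of
  \<open>A\<close>.\<close>

lemma strongly_closed_hull:
  assumes f: "is_projection f" "f \<in> U"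
  defines "J \<equiv> {T \<in> U. \<forall>X e. finite X \<longrightarrow> e > 0 \<longrightarrow>
    (\<exists>\<Phi>\<in>sandwich. \<forall>x\<in>X. norm ((\<Phi> f - T) \<star> x) < e)}"
  shows "two_sided_ideal J" "strongly_closed J" "f \<in> J"
proof -
  have JD: "\<exists>\<Phi>\<in>sandwich. \<forall>x\<in>X. norm ((\<Phi> f - T) \<star> x) < e" if "T \<in> J" "finite X" "e > 0" for T X e
    using that by (auto simp: J_def)
  have JI: "T \<in> J" if "T \<in> U"
    "\<And>X e. finite X \<Longrightarrow> e > 0 \<Longrightarrow> \<exists>\<Phi>\<in>sandwich. \<forall>x\<in>X. norm ((\<Phi> f - T) \<star> x) < e" for T
    using that by (auto simp: J_def)
  have in_J: "\<Phi> f \<in> J" if "\<Phi> \<in> sandwich" for \<Phi>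
    using that sandwich_in [OF that f(2)] by (intro JI) force+
  have "(\<lambda>c. 1 * c * 1 + 0) \<in> sandwich"
    by (intro sandwich.intros one_in)
  then show "f \<in> J"
    using in_J by force
  have plus: "S + T \<in> J" if ST: "S \<in> J" "T \<in> J" for S T
  proof (rule JI)
    show "S + T \<in> U"
      using ST plus_in by (auto simp: J_def)
    fix X :: "'a set" and e :: real assume "finite X" "e > 0"
    then obtain \<Phi> \<Psi> where \<Phi>: "\<Phi> \<in> sandwich" "\<And>x. x \<in> X \<Longrightarrow> norm ((\<Phi> f - S) \<star> x) < e / 2"
      and \<Psi>: "\<Psi> \<in> sandwich" "\<And>x. x \<in> X \<Longrightarrow> norm ((\<Psi> f - T) \<star> x) < e / 2"
      using JD [OF ST(1) \<open>finite X\<close>, of "e / 2"] JD [OF ST(2) \<open>finite X\<close>, of "e / 2"] by auto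
    have "norm ((\<Phi> f + \<Psi> f - (S + T)) \<star> x) < e" if "x \<in> X" for x
    proof -
      have "(\<Phi> f + \<Psi> f - (S + T)) \<star> x = ((\<Phi> f - S) \<star> x) + ((\<Psi> f - T) \<star> x)"
        by simp
      then show ?thesis
        using norm_add_less [OF \<Phi>(2) [OF that] \<Psi>(2) [OF that]] by (simp only: field_sum_of_halves)
    qed
    then show "\<exists>\<Phi>\<in>sandwich. \<forall>x\<in>X. norm ((\<Phi> f - (S + T)) \<star> x) < e"
      by (intro bexI [of _ "\<lambda>c. \<Phi> c + \<Psi> c"] ballI sandwich_plus \<Phi>(1) \<Psi>(1))
  qed
  have right: "T * A \<in> J" if T: "T \<in> J" and A: "A \<in> U" for T A
  proof (rule JI)
    show "T * A \<in> U"
      using T A times_in by (auto simp: J_def)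
    fix X :: "'a set" and e :: real assume "finite X" "e > 0"
    then obtain \<Phi> where "\<Phi> \<in> sandwich" "\<forall>x\<in>bop_apply A ` X. norm ((\<Phi> f - T) \<star> x) < e"
      using JD [OF T, of "bop_apply A ` X" e] by auto
    then show "\<exists>\<Phi>\<in>sandwich. \<forall>x\<in>X. norm ((\<Phi> f - T * A) \<star> x) < e"
      using sandwich_right [OF _ A] by (intro bexI [of _ "\<lambda>c. \<Phi> c * A"]) auto
  qed
  have left: "A * T \<in> J" if T: "T \<in> J" and A: "A \<in> U" for T A
  proof (rule JI)
    show "A * T \<in> U"
      using T A times_in by (auto simp: J_def)
    obtain a where a: "a > 0" "\<And>x. norm (A \<star> x) \<le> a * norm x"
      using bop_bound [of A] by blast
    fix X :: "'a set" and e :: real assume "finite X" "e > 0"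
    then obtain \<Phi> where \<Phi>: "\<Phi> \<in> sandwich" "\<And>x. x \<in> X \<Longrightarrow> norm ((\<Phi> f - T) \<star> x) < e / a"
      using JD [OF T, of X "e / a"] a(1) by auto
    have "norm ((A * \<Phi> f - A * T) \<star> x) < e" if "x \<in> X" for x
    proof -
      have "(A * \<Phi> f - A * T) \<star> x = A \<star> (\<Phi> f - T) \<star> x"
        by (simp add: bop_apply_diff_right)
      also have "norm \<dots> \<le> a * norm ((\<Phi> f - T) \<star> x)"
        by (rule a(2))
      also have "\<dots> < e"
        using \<Phi>(2) [OF that] a(1) by (simp add: pos_less_divide_eq mult.commute)
      finally show ?thesis .
    qed
    then show "\<exists>\<Phi>\<in>sandwich. \<forall>x\<in>X. norm ((\<Phi> f - A * T) \<star> x) < e"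
      by (intro bexI [of _ "\<lambda>c. A * \<Phi> c"] ballI sandwich_left \<Phi>(1) A)
  qed
  have "0 \<in> J"
    using in_J [OF sandwich.zero] .
  then show "two_sided_ideal J"
    using plus left right by (auto simp: two_sided_ideal_def J_def)
  show "strongly_closed J"
    unfolding strongly_closed_def
  proof (intro allI impI)
    fix T
    assume approx: "\<forall>X e. finite X \<longrightarrow> e > 0 \<longrightarrow> (\<exists>A\<in>J. \<forall>x\<in>X. norm ((A - T) \<star> x) < e)"
    then have "\<forall>X e. finite X \<longrightarrow> e > 0 \<longrightarrow> (\<exists>A\<in>U. \<forall>x\<in>X. norm ((A - T) \<star> x) < e)"
      unfolding J_def by blast
    then have "T \<in> U"
      using strongly_closed unfolding strongly_closed_def by blast
    then show "T \<in> J"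
    proof (rule JI)
      fix X :: "'a set" and e :: real assume "finite X" "e > 0"
      then have "e / 2 > 0"
        by simp
      obtain A where A: "A \<in> J" "\<And>x. x \<in> X \<Longrightarrow> norm ((A - T) \<star> x) < e / 2"
        using approx [rule_format, OF \<open>finite X\<close> \<open>e / 2 > 0\<close>] by blast
      obtain \<Phi> where \<Phi>: "\<Phi> \<in> sandwich" "\<And>x. x \<in> X \<Longrightarrow> norm ((\<Phi> f - A) \<star> x) < e / 2"
        using JD [OF A(1) \<open>finite X\<close> \<open>e / 2 > 0\<close>] by blast
      have "norm ((\<Phi> f - T) \<star> x) < e" if "x \<in> X" for x
      proof -
        have "(\<Phi> f - T) \<star> x = ((\<Phi> f - A) \<star> x) + ((A - T) \<star> x)"
          by simp
        then show ?thesis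
          using norm_add_less [OF \<Phi>(2) [OF that] A(2) [OF that]] by (simp only: field_sum_of_halves)
      qed
      then show "\<exists>\<Phi>\<in>sandwich. \<forall>x\<in>X. norm ((\<Phi> f - T) \<star> x) < e"
        using \<Phi>(1) by blast
    qed
  qed
qed

text \<open>When \<open>\<Phi> f\<close> tends to \<open>E\<close> and \<open>\<Phi> c\<close> to
  \<open>Z\<close>, this becomes \<open>Z * A * f = A * c\<close> in the limit, which says that
  \<open>Z\<close> acts on \<open>U f\<close> as right multiplication by \<open>c\<close>.\<close>

lemma sandwich_corner_center:
  assumes c: "c \<in> corner_center f" and "A \<in> U" and "\<Phi> \<in> sandwich"
  shows "\<Phi> c * A * f = \<Phi> f * A * c"
  using assms(3)
proof induction
  case (step B D \<Phi>)
  have "c * (D * A) * f = f * (D * A) * c"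
    by (rule corner_centerD(4) [OF c]) (simp add: step assms times_in)
  then have "B * (c * (D * A) * f) = B * (f * (D * A) * c)"
    by (rule arg_cong)
  then show ?case
    using step.IH by (simp add: distrib_right mult.assoc)
qed simp

text \<open>If a central \<open>z\<close> with \<open>z * f = c\<close> exists, then
  \<open>\<Phi> c = z * \<Phi> f\<close> for every sandwich map, so \<open>z * E\<close> must be the
  limit of \<open>\<Phi> c\<close> as \<open>\<Phi> f\<close> tends to \<open>E\<close>. The proof
  shows that this limit exists and does the job.\<close>

lemma corner_center_extends:
  assumes E: "E \<in> center U" "is_projection E" and f: "is_projection f" "f \<in> U" "E * f = f"
    and faithful: "\<And>T. T \<in> U \<Longrightarrow> T * E = T \<Longrightarrow> (\<And>X. X \<in> U \<Longrightarrow> T * X * f = 0) \<Longrightarrow> T = 0"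
    and c: "c \<in> corner_center f"
  obtains z where "z \<in> center U" "z * f = c"
proof -
  have EU: "E \<in> U" and E_comm: "\<And>A. A \<in> U \<Longrightarrow> E * A = A * E" and EE: "E * E = E"
    using E center_in center_commute is_projectionD(2) by auto
  define J where "J = {T \<in> U. \<forall>X e. finite X \<longrightarrow> e > 0 \<longrightarrow>
    (\<exists>\<Phi>\<in>sandwich. \<forall>x\<in>X. norm ((\<Phi> f - T) \<star> x) < e)}"
  note J = strongly_closed_hull [OF f(1,2), folded J_def]
  obtain Q where Q: "Q \<in> center U" "Q \<in> J" "\<And>A. A \<in> J \<Longrightarrow> Q * A = A"
    using ideal_unit [OF J(1,2)] by blast
  \<comment> \<open>The unit \<open>Q\<close> of \<open>J\<close> fixes \<open>f\<close>, so
    \<open>E - Q * E\<close> annihilates \<open>U f\<close>. This puts \<open>E\<close> into the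
    strong closure \<open>J\<close>.\<close>
  have "E - Q * E = 0"
  proof (rule faithful)
    show "E - Q * E \<in> U"
      by (intro minus_in times_in EU center_in Q)
    show "(E - Q * E) * E = E - Q * E"
      by (simp add: left_diff_distrib mult.assoc EE)
    fix X assume X: "X \<in> U"
    have "Q * E * X * f = Q * (X * (E * f))"
      by (simp only: mult.assoc) (simp only: mult.assoc [symmetric] E_comm [OF X])
    also have "\<dots> = X * (Q * f)"
      using center_commute [OF Q(1) X] f(3) by (metis mult.assoc)
    also have "\<dots> = E * X * f"
      using Q(3) [OF J(3)] E_comm [OF X] f(3) by (metis mult.assoc)
    finally show "(E - Q * E) * X * f = 0"
      by (simp add: left_diff_distrib)
  qed
  then have "E = Q * E"
    by simp
  moreover have "Q * E \<in> J"
    using J(1) Q(2) EU by (auto simp: two_sided_ideal_def)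
  ultimately have "E \<in> J"
    by simp
  obtain b where b: "b > 0"
    "\<And>\<Phi> y. \<Phi> \<in> sandwich \<Longrightarrow> norm (\<Phi> c \<star> y) \<le> b * norm (\<Phi> f \<star> y)"
    using sandwich_norm_le [OF f(1,2) c] by blast
  \<comment> \<open>The sandwich maps whose value at \<open>f\<close> lies in a given strong
    neighbourhood of \<open>E\<close>; they generate the filter along which limits are
    taken.\<close>
  define near where "near = (\<lambda>(X, e). {\<Phi> \<in> sandwich. \<forall>x\<in>X. norm ((\<Phi> f - E) \<star> x) < e})"
  define I where "I = {(X :: 'a set, e :: real). finite X \<and> e > 0}"
  define \<F> where "\<F> = (INF i\<in>I. principal (near i))"
  have ev: "eventually Pr \<F> \<longleftrightarrow> (\<exists>i\<in>I. \<forall>\<Phi>\<in>near i. Pr \<Phi>)" for Pr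
  proof -
    have "({}, 1) \<in> I"
      by (simp add: I_def)
    then have ne: "I \<noteq> {}"
      by blast
    have "\<exists>i\<in>I. principal (near i) \<le> inf (principal (near j)) (principal (near k))"
      if "j \<in> I" "k \<in> I" for j k
    proof -
      obtain X e Y d where jk: "j = (X, e)" "k = (Y, d)"
        by (cases j, cases k)
      have "(X \<union> Y, min e d) \<in> I"
        using that by (simp add: jk I_def)
      moreover have "near (X \<union> Y, min e d) \<subseteq> near j \<inter> near k"
        by (auto simp: jk near_def)
      ultimately show ?thesis
        by auto
    qed
    then show ?thesis
      unfolding \<F>_def by (simp add: eventually_INF_base [OF ne] eventually_principal)
  qed
  have nontriv: "\<F> \<noteq> bot"
  proof -
    have "near i \<noteq> {}" if "i \<in> I" for i
    proof -
      obtain X e where i: "i = (X, e)" "finite X" "e > 0"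
        using \<open>i \<in> I\<close> by (auto simp: I_def)
      then have "\<exists>\<Phi>\<in>sandwich. \<forall>x\<in>X. norm ((\<Phi> f - E) \<star> x) < e"
        using \<open>E \<in> J\<close> by (simp add: J_def del: bop_apply_minus)
      then show ?thesis
        by (auto simp: i(1) near_def simp del: bop_apply_minus)
    qed
    then show ?thesis
      unfolding trivial_limit_def ev by blast
  qed
  have ev_in: "\<forall>\<^sub>F \<Phi> in \<F>. \<Phi> \<in> sandwich"
    unfolding ev by (rule bexI [of _ "({}, 1)"]) (auto simp: near_def I_def)
  have ev_near: "\<forall>\<^sub>F \<Phi> in \<F>. \<Phi> \<in> sandwich \<and> norm ((\<Phi> f - E) \<star> x) < e" if "e > 0" for x e
    unfolding ev by (rule bexI [of _ "({x}, e)"]) (use that in \<open>auto simp: near_def I_def\<close>)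
  have lim_E: "((\<lambda>\<Phi>. \<Phi> f \<star> x) \<longlongrightarrow> E \<star> x) \<F>" for x
  proof (rule tendstoI)
    fix e :: real assume "e > 0"
    show "\<forall>\<^sub>F \<Phi> in \<F>. dist (\<Phi> f \<star> x) (E \<star> x) < e"
      using ev_near [OF \<open>e > 0\<close>, of x] by eventually_elim (simp add: dist_norm)
  qed
  have conv: "\<exists>l. ((\<lambda>\<Phi>. \<Phi> c \<star> x) \<longlongrightarrow> l) \<F>" for x
  proof (rule convergent_filter_Cauchy [OF nontriv])
    fix e :: real assume "e > 0"
    \<comment> \<open>Two maps within \<open>d\<close> of \<open>E\<close> at \<open>x\<close>
      differ there by less than \<open>2 * d\<close>, and the factor \<open>b\<close> turns this
      into \<open>e\<close>.\<close>
    define d where "d = e / (2 * b)"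
    have "d > 0"
      using \<open>e > 0\<close> b(1) by (simp add: d_def)
    have near: "\<forall>\<^sub>F \<Phi> in \<F>. \<Phi> \<in> sandwich \<and> norm ((\<Phi> f - E) \<star> x) < d"
      by (rule ev_near [OF \<open>d > 0\<close>])
    then obtain \<Psi> where \<Psi>: "\<Psi> \<in> sandwich" "norm ((\<Psi> f - E) \<star> x) < d"
      using eventually_happens' [OF nontriv] by blast
    have "\<forall>\<^sub>F \<Phi> in \<F>. dist (\<Phi> c \<star> x) (\<Psi> c \<star> x) < e"
      using near
    proof eventually_elim
      case (elim \<Phi>)
      have "dist (\<Phi> c \<star> x) (\<Psi> c \<star> x) = norm ((\<Phi> c - \<Psi> c) \<star> x)"
        by (simp add: dist_norm)
      also have "\<dots> \<le> b * norm ((\<Phi> f - \<Psi> f) \<star> x)"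
        using b(2) [OF sandwich_minus [OF conjunct1 [OF elim] \<Psi>(1)]] by simp
      also have "(\<Phi> f - \<Psi> f) \<star> x = ((\<Phi> f - E) \<star> x) - ((\<Psi> f - E) \<star> x)"
        by simp
      also have "b * norm \<dots> < b * (d + d)"
        using elim \<Psi>(2) b(1) norm_triangle_ineq4 [of "(\<Phi> f - E) \<star> x" "(\<Psi> f - E) \<star> x"]
        by (intro mult_strict_left_mono) linarith+
      also have "\<dots> = e"
        using b(1) by (simp add: d_def)
      finally show ?case .
    qed
    then show "\<exists>y. \<forall>\<^sub>F \<Phi> in \<F>. dist (\<Phi> c \<star> x) y < e"
      by blast
  qed
  have bound: "norm l \<le> b * norm x" if l: "((\<lambda>\<Phi>. \<Phi> c \<star> x) \<longlongrightarrow> l) \<F>" for x l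
  proof -
    have "norm l \<le> b * norm (E \<star> x)"
    proof (rule tendsto_le [OF nontriv _ tendsto_norm [OF l]])
      show "((\<lambda>\<Phi>. b * norm (\<Phi> f \<star> x)) \<longlongrightarrow> b * norm (E \<star> x)) \<F>"
        by (intro tendsto_mult tendsto_const tendsto_norm lim_E)
      show "\<forall>\<^sub>F \<Phi> in \<F>. norm (\<Phi> c \<star> x) \<le> b * norm (\<Phi> f \<star> x)"
        using ev_in by eventually_elim (rule b(2))
    qed
    also have "\<dots> \<le> b * norm x"
      using b(1) by (intro mult_left_mono norm_projection_le E) auto
    finally show ?thesis .
  qed
  obtain Z where Z: "\<And>x. ((\<lambda>\<Phi>. \<Phi> c \<star> x) \<longlongrightarrow> Z \<star> x) \<F>"
    using bop_limit [OF nontriv conv bound] by auto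
  have "Z \<in> U"
  proof (rule strongly_closed_limit [OF strongly_closed nontriv _ Z])
    show "\<forall>\<^sub>F \<Phi> in \<F>. \<Phi> c \<in> U"
      using ev_in by eventually_elim (rule sandwich_in [OF _ corner_centerD(1) [OF c]])
  qed
  have ZA: "Z * A * f = A * c" if A: "A \<in> U" for A
  proof (rule bop_eqI)
    fix x
    have "\<forall>\<^sub>F \<Phi> in \<F>. \<Phi> f \<star> A \<star> c \<star> x = \<Phi> c \<star> A \<star> f \<star> x"
      using ev_in by eventually_elim (metis sandwich_corner_center [OF c A] bop_apply_times)
    then have "((\<lambda>\<Phi>. \<Phi> c \<star> A \<star> f \<star> x) \<longlongrightarrow> E \<star> A \<star> c \<star> x) \<F>"
      by (rule Lim_transform_eventually [OF lim_E])
    then have "Z \<star> A \<star> f \<star> x = E \<star> A \<star> c \<star> x"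
      using tendsto_unique [OF nontriv Z] by blast
    moreover have "E * A * c = A * c"
      using E_comm [OF A] f(3) corner_centerD(2) [OF c] by (metis mult.assoc)
    ultimately show "(Z * A * f) \<star> x = (A * c) \<star> x"
      by (metis bop_apply_times)
  qed
  \<comment> \<open>By \<open>ZA\<close> both products send \<open>X * f\<close> to
    \<open>E * A * X * c\<close>. The factor \<open>E\<close> keeps the commutator inside
    \<open>U E\<close>, where \<open>faithful\<close> applies.\<close>
  have "E * Z * A - A * (E * Z) = 0" if A: "A \<in> U" for A
  proof (rule faithful)
    show "E * Z * A - A * (E * Z) \<in> U"
      by (intro minus_in times_in EU A \<open>Z \<in> U\<close>)
    show "(E * Z * A - A * (E * Z)) * E = E * Z * A - A * (E * Z)"
      by (simp add: left_diff_distrib mult.assoc EE mult_absorb [OF EE]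
          mult_absorb [OF E_comm [OF A, symmetric]] mult_absorb [OF E_comm [OF \<open>Z \<in> U\<close>, symmetric]]
          E_comm [OF A, symmetric] E_comm [OF \<open>Z \<in> U\<close>, symmetric])
    fix X assume X: "X \<in> U"
    have "E * Z * A * X * f = E * (Z * (A * X) * f)"
      by (simp add: mult.assoc)
    also have "\<dots> = E * (A * X * c)"
      using A X by (simp add: ZA times_in)
    also have "\<dots> = E * A * (X * c)"
      by (simp add: mult.assoc)
    also have "\<dots> = A * E * (X * c)"
      by (simp add: E_comm [OF A])
    also have "X * c = Z * X * f"
      using ZA [OF X] by simp
    finally show "(E * Z * A - A * (E * Z)) * X * f = 0"
      by (simp add: left_diff_distrib mult.assoc)
  qed
  then have "E * Z \<in> center U"
    using times_in [OF EU \<open>Z \<in> U\<close>] by (simp add: center_def)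
  moreover have "E * Z * f = c"
    using ZA [OF one_in] f(3) corner_centerD(2) [OF c] by (metis mult.assoc mult_1_left mult_1_right)
  ultimately show thesis
    using that by blast
qed

section \<open>Invertible elements\<close>

text \<open>The Neumann series of \<open>1 - k\<close> with \<open>k = - A / r\<close>. Its partial
  sums converge strongly, so the inverse stays in \<open>U\<close>.\<close>

lemma eventually_invertible:
  assumes "A \<in> U"
  obtains b :: real where "b > 0"
    "\<And>r. r > b \<Longrightarrow> \<exists>T\<in>U. (complex_of_real r *\<^sub>C 1 + A) * T = 1 \<and> T * (complex_of_real r *\<^sub>C 1 + A) = 1"
proof -
  obtain b where b: "b > 0" "\<And>x. norm (A \<star> x) \<le> b * norm x"
    using bop_bound [of A] by blast
  have "\<exists>T\<in>U. (complex_of_real r *\<^sub>C 1 + A) * T = 1 \<and> T * (complex_of_real r *\<^sub>C 1 + A) = 1"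
    if r: "r > b" for r
  proof -
    have "r > 0"
      using r b(1) by simp
    define k where "k = complex_of_real (- 1 / r) *\<^sub>C A"
    define q where "q = b / r"
    have q: "0 \<le> q" "q < 1"
      using r b(1) by (auto simp: q_def)
    have kU: "k \<in> U"
      unfolding k_def by (rule scaleC_in [OF assms])
    have norm_k: "norm (k \<star> x) \<le> q * norm x" for x
      using b(2) [of x] \<open>r > 0\<close> by (simp add: k_def q_def norm_scaleC norm_divide divide_right_mono)
    have norm_pow: "norm ((k ^ m) \<star> x) \<le> norm x * q ^ m" for m x
    proof (induction m)
      case (Suc m)
      have "norm ((k ^ Suc m) \<star> x) \<le> q * norm ((k ^ m) \<star> x)"
        using norm_k by simp
      also have "\<dots> \<le> q * (norm x * q ^ m)"
        using Suc q by (intro mult_left_mono) auto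
      finally show ?case
        by (simp add: mult_ac)
    qed simp
    define S where "S = (\<lambda>m. \<Sum>i<m. k ^ i)"
    have S_Suc: "S (Suc m) = S m + k ^ m" for m
      by (simp add: S_def)
    have S_apply: "S m \<star> x = (\<Sum>i<m. (k ^ i) \<star> x)" for m x
      by (induction m) (simp_all add: S_def)
    have S_in: "S m \<in> U" for m
    proof -
      have "k ^ i \<in> U" for i
        by (induction i) (auto simp: one_in times_in kU)
      then show ?thesis
        by (induction m) (auto simp: S_def zero_in plus_in)
    qed
    have summ: "summable (\<lambda>m. norm x * q ^ m)" for x :: 'a
      using q by (intro summable_mult summable_geometric) auto
    have sums: "(\<lambda>m. (k ^ m) \<star> x) sums (\<Sum>m. (k ^ m) \<star> x)" for x
      by (rule summable_sums [OF summable_comparison_test' [OF summ norm_pow]])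
    have conv: "\<exists>l. (\<lambda>m. S m \<star> x) \<longlonglongrightarrow> l" for x
      using sums [of x] unfolding sums_def S_apply by blast
    have bound: "norm l \<le> 1 / (1 - q) * norm x" if "(\<lambda>m. S m \<star> x) \<longlonglongrightarrow> l" for x l
    proof -
      have "l = (\<Sum>m. (k ^ m) \<star> x)"
        using LIMSEQ_unique [OF that] sums [of x] unfolding sums_def S_apply by blast
      also have "norm \<dots> \<le> (\<Sum>m. norm x * q ^ m)"
        by (rule norm_suminf_le [OF norm_pow summ])
      finally show ?thesis
        using q by (simp add: suminf_mult suminf_geometric)
    qed
    obtain T where T: "\<And>x. (\<lambda>m. S m \<star> x) \<longlonglongrightarrow> T \<star> x"
      using bop_limit [OF sequentially_bot conv bound] by auto
    have TU: "T \<in> U"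
      by (rule strongly_closed_limit [OF strongly_closed sequentially_bot _ T]) (simp add: S_in)
    have telescope: "(1 - k) * S m = 1 - k ^ m \<and> S m * (1 - k) = 1 - k ^ m" for m
    proof (induction m)
      case (Suc m)
      have "(1 - k) * S (Suc m) = (1 - k) * S m + (k ^ m - k * k ^ m)"
        "S (Suc m) * (1 - k) = S m * (1 - k) + (k ^ m - k ^ m * k)"
        by (simp_all add: S_Suc algebra_simps)
      then show ?case
        using Suc by (simp add: power_commutes)
    qed (simp add: S_def)
    have pow_0: "(\<lambda>m. (k ^ m) \<star> x) \<longlonglongrightarrow> 0" for x
      by (rule summable_LIMSEQ_zero [OF sums_summable [OF sums]])
    have pow_1: "(\<lambda>m. (1 - k ^ m) \<star> x) \<longlonglongrightarrow> x" for x
      using tendsto_diff [OF tendsto_const pow_0, of x] by simp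
    have "(1 - k) * T = 1"
    proof (rule bop_eqI)
      fix x
      have "(\<lambda>m. (1 - k) \<star> S m \<star> x) \<longlonglongrightarrow> (1 - k) \<star> T \<star> x"
        by (rule tendsto_bop_apply [OF T])
      moreover have "(1 - k) \<star> S m \<star> x = (1 - k ^ m) \<star> x" for m
        using telescope [of m] by (metis bop_apply_times)
      ultimately have "(\<lambda>m. (1 - k ^ m) \<star> x) \<longlonglongrightarrow> (1 - k) \<star> T \<star> x"
        by (simp only:)
      then have "(1 - k) \<star> T \<star> x = x"
        by (rule LIMSEQ_unique [OF _ pow_1])
      then show "((1 - k) * T) \<star> x = 1 \<star> x"
        by (simp only: bop_apply_times bop_apply_one)
    qed
    moreover have "T * (1 - k) = 1"
    proof (rule bop_eqI)
      fix x
      have "(\<lambda>m. S m \<star> (1 - k) \<star> x) \<longlonglongrightarrow> T \<star> (1 - k) \<star> x"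
        by (rule T)
      moreover have "S m \<star> (1 - k) \<star> x = (1 - k ^ m) \<star> x" for m
        using telescope [of m] by (metis bop_apply_times)
      ultimately have "(\<lambda>m. (1 - k ^ m) \<star> x) \<longlonglongrightarrow> T \<star> (1 - k) \<star> x"
        by (simp only:)
      then have "T \<star> (1 - k) \<star> x = x"
        by (rule LIMSEQ_unique [OF _ pow_1])
      then show "(T * (1 - k)) \<star> x = 1 \<star> x"
        by (simp only: bop_apply_times bop_apply_one)
    qed
    moreover have "complex_of_real r *\<^sub>C 1 + A = complex_of_real r *\<^sub>C (1 - k)"
    proof (rule bop_eqI)
      fix x
      have "complex_of_real r *\<^sub>C (k \<star> x) = complex_of_real (- 1) *\<^sub>C (A \<star> x)"
        using \<open>r > 0\<close> by (simp add: k_def scaleC_scaleC)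
      also have "\<dots> = - (A \<star> x)"
        by (simp only: scaleC_of_real) simp
      finally show "(complex_of_real r *\<^sub>C 1 + A) \<star> x = (complex_of_real r *\<^sub>C (1 - k)) \<star> x"
        by (simp add: scaleC_diff_right)
    qed
    moreover have "complex_of_real r * complex_of_real (1 / r) = 1"
      "complex_of_real (1 / r) * complex_of_real r = 1"
      using \<open>r > 0\<close> by auto
    ultimately have "(complex_of_real r *\<^sub>C 1 + A) * (complex_of_real (1 / r) *\<^sub>C T) = 1"
      "complex_of_real (1 / r) *\<^sub>C T * (complex_of_real r *\<^sub>C 1 + A) = 1"
      by (simp_all only: scaleC_times_scaleC scaleC_one_bop)
    then show ?thesis
      using scaleC_in [OF TU] by blast
  qed
  then show thesis
    using that b(1) by blast
qed

end

section \<open>Rings with a Peirce decomposition\<close>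

lemma commutator_simps:
  fixes a b c :: "'a::ring"
  shows "commutator (a + b) c = commutator a c + commutator b c"
    and "commutator a (b + c) = commutator a b + commutator a c"
    and "commutator (a - b) c = commutator a c - commutator b c"
    and "commutator a (b - c) = commutator a b - commutator a c"
    and "commutator (- a) b = - commutator a b"
    and "commutator 0 a = 0"
    and "commutator a 0 = 0"
    and "commutator a a = 0"
  by (simp_all add: commutator_def algebra_simps)

lemma commutator_eq_0_iff: "commutator a b = 0 \<longleftrightarrow> a * b = b * (a :: 'a::ring)"
  by (simp add: commutator_def)

lemma foldl_commutator_diff:
  "foldl commutator (a - b) Bs = foldl commutator a Bs - foldl commutator (b :: 'a::ring) Bs"
  by (induction Bs arbitrary: a b) (simp_all add: commutator_simps)

lemma foldl_commutator_zero: "foldl commutator 0 Bs = (0 :: 'a::ring)"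
  by (induction Bs) (simp_all add: commutator_simps)

definition corner_unit :: "'a::ring set \<Rightarrow> 'a \<Rightarrow> 'a \<Rightarrow> bool" where
  "corner_unit U e s \<longleftrightarrow> s \<in> U \<and> e * s = s \<and> s * e = s \<and>
     (\<exists>t\<in>U. e * t = t \<and> t * e = t \<and> s * t = e \<and> t * s = e)"

text \<open>This separates algebra from analysis. \<open>complement_central\<close> records the
  abelian summand, \<open>faithful_e\<close> and \<open>faithful_f\<close> the central carrier and
  core-freeness, and \<open>central_square_zero\<close> the adjoint. In the last axiom
  \<open>r + e\<close> must be a unit along with \<open>r\<close>, because \<open>D e\<close> is
  reached by comparing \<open>D r\<close> with \<open>D (r + e)\<close>.\<close>

locale peirce =
  fixes U :: "'a::{ring,monoid_mult} set" and e E :: 'a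
  assumes one_in: "1 \<in> U"
    and plus_in: "x \<in> U \<Longrightarrow> y \<in> U \<Longrightarrow> x + y \<in> U"
    and minus_in: "x \<in> U \<Longrightarrow> y \<in> U \<Longrightarrow> x - y \<in> U"
    and times_in: "x \<in> U \<Longrightarrow> y \<in> U \<Longrightarrow> x * y \<in> U"
    and e_in: "e \<in> U" and ee: "e * e = e"
    and E_center: "E \<in> center U" and EE: "E * E = E" and Ee: "E * e = e"
    and complement_central: "x \<in> U \<Longrightarrow> (1 - E) * x \<in> center U"
    and central_square_zero: "c \<in> center U \<Longrightarrow> c * c = 0 \<Longrightarrow> c = 0"
    and faithful_e: "x \<in> U \<Longrightarrow> x * E = x \<Longrightarrow> (\<And>y. y \<in> U \<Longrightarrow> x * y * e = 0) \<Longrightarrow> x = 0"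
    and faithful_f: "x \<in> U \<Longrightarrow> x * E = x \<Longrightarrow> (\<And>y. y \<in> U \<Longrightarrow> x * y * (E - e) = 0) \<Longrightarrow> x = 0"
    and faithful_e_left: "x \<in> U \<Longrightarrow> x * E = x \<Longrightarrow> (\<And>y. y \<in> U \<Longrightarrow> e * y * x = 0) \<Longrightarrow> x = 0"
    and corner_spanned_by_units: "a \<in> U \<Longrightarrow> e * a = a \<Longrightarrow> a * e = a \<Longrightarrow>
      \<exists>r s. a = r - s \<and> corner_unit U e r \<and> corner_unit U e (r + e)
        \<and> corner_unit U e s \<and> corner_unit U e (s + e)"
begin

lemma zero_in: "0 \<in> U"
  using minus_in [OF one_in one_in] by simp

lemma E_in: "E \<in> U"
  using E_center by (simp add: center_def)

lemma E_commute: "x \<in> U \<Longrightarrow> E * x = x * E"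
  using E_center by (simp add: center_def)

lemma eE: "e * E = e"
  using E_commute [OF e_in] Ee by simp

lemma center_in: "c \<in> center U \<Longrightarrow> c \<in> U"
  by (simp add: center_def)

lemma center_commute: "c \<in> center U \<Longrightarrow> x \<in> U \<Longrightarrow> c * x = x * c"
  by (simp add: center_def)

lemma center_plus: "c \<in> center U \<Longrightarrow> d \<in> center U \<Longrightarrow> c + d \<in> center U"
  by (simp add: center_def plus_in distrib_left distrib_right)

lemma center_minus: "c \<in> center U \<Longrightarrow> d \<in> center U \<Longrightarrow> c - d \<in> center U"
  by (simp add: center_def minus_in left_diff_distrib right_diff_distrib)

lemma center_zero: "0 \<in> center U"
  by (simp add: center_def zero_in)

lemma center_times: "c \<in> center U \<Longrightarrow> d \<in> center U \<Longrightarrow> c * d \<in> center U"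
  unfolding center_def mem_Collect_eq using times_in by (metis mult.assoc)

lemma commutator_in: "x \<in> U \<Longrightarrow> y \<in> U \<Longrightarrow> commutator x y \<in> U"
  by (simp add: commutator_def minus_in times_in)

lemma commutator_center_left: "c \<in> center U \<Longrightarrow> x \<in> U \<Longrightarrow> commutator c x = 0"
  by (simp add: center_def commutator_def)

lemma commutator_center_right: "c \<in> center U \<Longrightarrow> x \<in> U \<Longrightarrow> commutator x c = 0"
  by (simp add: center_def commutator_def)

text \<open>Expanding the commutator of \<open>t\<close> with \<open>t x\<close> shows that \<open>[t, x]\<^sup>2 = 0\<close>.\<close>

lemma commutators_central_imp_central:
  assumes t: "t \<in> U" and central: "\<And>x. x \<in> U \<Longrightarrow> commutator t x \<in> center U"
  shows "t \<in> center U"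
proof -
  have "commutator t x = 0" if x: "x \<in> U" for x
  proof (rule central_square_zero [OF central [OF x]])
    let ?c = "commutator t x"
    have "commutator t (t * x) = t * ?c"
      by (simp add: commutator_def right_diff_distrib mult.assoc)
    then have "t * ?c \<in> center U"
      using central [OF times_in [OF t x]] by simp
    then have "t * ?c * x = x * (t * ?c)"
      using x by (rule center_commute)
    moreover have "?c * x = x * ?c"
      using central [OF x] x by (rule center_commute)
    ultimately have "t * x * ?c = x * t * ?c"
      by (metis mult.assoc)
    then show "?c * ?c = 0"
      by (subst (1) commutator_def) (simp add: left_diff_distrib)
  qed
  then show ?thesis
    using t by (simp add: center_def commutator_eq_0_iff)
qed

text \<open>This peels off the trailing arguments of \<open>p\<^sub>n\<close> one at a time, and so
  reduces every n to a statement about the first commutator.\<close>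

lemma foldl_commutator_central_imp_central:
  assumes "t \<in> U"
    and "\<And>Bs. length Bs = k \<Longrightarrow> set Bs \<subseteq> U \<Longrightarrow> foldl commutator t Bs \<in> center U"
  shows "t \<in> center U"
  using assms
proof (induction k arbitrary: t)
  case 0
  then show ?case
    using "0.prems"(2) [of "[]"] by simp
next
  case (Suc k)
  show ?case
  proof (rule commutators_central_imp_central [OF Suc.prems(1)])
    fix x assume x: "x \<in> U"
    show "commutator t x \<in> center U"
    proof (rule Suc.IH [OF commutator_in [OF Suc.prems(1) x]])
      show "foldl commutator (commutator t x) Bs \<in> center U" if "length Bs = k" "set Bs \<subseteq> U" for Bs
        using Suc.prems(2) [of "x # Bs"] that x by simp
    qed
  qed
qed

text \<open>The commutator of \<open>m\<close> with the idempotent \<open>e\<close> is off-diagonal,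
  and an off-diagonal element commuting with \<open>e\<close> vanishes.\<close>

lemma central_commutator_e:
  assumes "m \<in> U" "commutator m e \<in> center U"
  shows "m * e = e * m"
proof -
  have "commutator m e * e = e * commutator m e"
    using assms(2) e_in by (rule center_commute)
  then have *: "m * e - e * m * e = e * m * e - e * m"
    by (simp add: commutator_def left_diff_distrib right_diff_distrib mult.assoc ee mult_absorb [OF ee])
  then have "e * (m * e - e * m * e) = e * (e * m * e - e * m)"
    by simp
  then have "e * m * e = e * m"
    by (simp add: right_diff_distrib mult.assoc mult_absorb [OF ee])
  then show ?thesis
    using * by simp
qed

text \<open>A central element passes through every \<open>y\<close>, so killing \<open>e\<close>
  means killing \<open>U e\<close>, and being supported under \<open>e\<close> means killing
  \<open>U (E - e)\<close>.\<close>

lemma central_corner_zero: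
  assumes "c \<in> center U" "c * E = c" "c * e = 0 \<or> c * e = c"
  shows "c = 0"
proof -
  have swap: "c * y * z = y * (c * z)" if "y \<in> U" for y z
    using center_commute [OF assms(1) that] by (simp add: mult.assoc [symmetric])
  show ?thesis
    using assms(3)
  proof
    assume zero: "c * e = 0"
    show ?thesis
      by (rule faithful_e) (simp_all add: center_in assms(1,2) swap zero)
  next
    assume "c * e = c"
    then have zero: "c * (E - e) = 0"
      using assms(2) by (simp add: right_diff_distrib)
    show ?thesis
      by (rule faithful_f) (simp_all add: center_in assms(1,2) swap zero)
  qed
qed

lemma central_off_diagonal_zero:
  assumes "c \<in> center U" "e * c = c" "c * e = 0"
  shows "c = 0"
  using center_commute [OF assms(1) e_in] assms(2,3) by simp

lemma times_E: "x * e = x \<Longrightarrow> x * E = x" "x \<in> U \<Longrightarrow> e * x = x \<Longrightarrow> x * E = x"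
proof -
  show "x * e = x \<Longrightarrow> x * E = x"
    using eE by (metis mult.assoc)
  show "x \<in> U \<Longrightarrow> e * x = x \<Longrightarrow> x * E = x"
    using E_commute [of x] Ee by (metis mult.assoc)
qed

text \<open>Each commutator of \<open>m\<close> with a Peirce component is annihilated by \<open>e U f\<close>, where
  \<open>f = E - e\<close>.\<close>

lemma commutes_off_diagonal_imp_central:
  assumes m: "m \<in> U" "m * e = e * m"
    and comm: "\<And>y. y \<in> U \<Longrightarrow> e * y = y \<Longrightarrow> y * e = 0 \<Longrightarrow> m * y = y * m"
  shows "m \<in> center U"
proof -
  have off: "e * y * (E - e) \<in> U" "e * (e * y * (E - e)) = e * y * (E - e)"
    "e * y * (E - e) * e = 0" if "y \<in> U" for y
    using that by (auto simp: times_in minus_in e_in E_in mult_absorb [OF ee] mult.assoc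
        left_diff_distrib Ee ee)
  have corner: "m * a = a * m" if a: "a \<in> U" "e * a = a" "a * e = a" for a
  proof -
    have "m * a - a * m = 0"
    proof (rule faithful_f)
      show "m * a - a * m \<in> U"
        by (intro minus_in times_in m a)
      have cE: "(m * a - a * m) * e = m * a - a * m"
        using a m(2) by (simp add: left_diff_distrib mult.assoc) (metis mult.assoc)
      show "(m * a - a * m) * E = m * a - a * m"
        by (rule times_E(1) [OF cE])
      fix y assume y: "y \<in> U"
      define z where "z = e * y * (E - e)"
      have z: "z \<in> U" "e * z = z" "z * e = 0"
        unfolding z_def by (rule off [OF y])+
      have "m * z = z * m"
        by (rule comm [OF z])
      moreover have "m * (a * z) = a * z * m"
        by (rule comm) (use a z in \<open>simp_all add: times_in mult_absorb [OF a(2)] mult.assoc\<close>)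
      ultimately have "(m * a - a * m) * z = 0"
        by (simp add: left_diff_distrib mult.assoc)
      then show "(m * a - a * m) * y * (E - e) = 0"
        using cE unfolding z_def by (metis mult.assoc)
    qed
    then show ?thesis by simp
  qed
  have diag: "m * b = b * m" if b: "b \<in> U" "e * b = 0" "b * e = 0" for b
  proof -
    define c where "c = E * (m * b - b * m)"
    have cU: "c \<in> U"
      unfolding c_def by (intro minus_in times_in m b E_in)
    have "e * (m * b) = 0"
      using b(2) m(2) by (metis mult.assoc mult_zero_right)
    then have ec: "e * c = 0"
      by (simp add: c_def mult_absorb [OF eE] right_diff_distrib mult_absorb [OF b(2)])
    have "c = 0"
    proof (rule faithful_e_left [OF cU])
      show "c * E = c"
        using E_commute [OF cU] by (simp add: c_def mult_absorb [OF EE])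
      fix y assume y: "y \<in> U"
      define z where "z = e * y * (E - e)"
      have z: "z \<in> U" "e * z = z" "z * e = 0"
        unfolding z_def by (rule off [OF y])+
      have "m * z = z * m"
        by (rule comm [OF z])
      moreover have "m * (z * b) = z * b * m"
        by (rule comm) (use b z in \<open>simp_all add: times_in mult_absorb [OF z(2)] mult.assoc\<close>)
      ultimately have "z * (m * b) = z * (b * m)"
        by (metis mult.assoc)
      then have "z * (m * b - b * m) = 0"
        by (simp add: right_diff_distrib)
      moreover have "z * E = z"
        using z times_E(2) by blast
      ultimately have "z * c = 0"
        unfolding c_def by (simp add: mult.assoc [symmetric])
      moreover have "e * y * c = z * c"
        unfolding z_def using ec E_commute [OF cU]
        by (simp add: mult.assoc left_diff_distrib) (simp add: c_def mult_absorb [OF EE])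
      ultimately show "e * y * c = 0"
        by simp
    qed
    \<comment> \<open>Since \<open>b\<close> need not lie in \<open>U E\<close>, its part in the
      abelian summand is treated separately; there \<open>(1 - E) * m\<close> is central.\<close>
    moreover have "(1 - E) * (m * b) = (1 - E) * (b * m)"
    proof -
      have "(1 - E) * m * b = b * ((1 - E) * m)" "(1 - E) * b = b * (1 - E)"
        using center_commute [OF complement_central [OF m(1)] b(1)]
          center_commute [OF complement_central [OF one_in] b(1)] by simp_all
      then show ?thesis
        by (metis mult.assoc)
    qed
    ultimately show ?thesis
      unfolding c_def by (simp add: left_diff_distrib right_diff_distrib)
  qed
  \<comment> \<open>This component depends on \<open>diag\<close>, as the product
    \<open>x * z\<close> lies in the complementary corner.\<close>
  have lower: "m * x = x * m" if x: "x \<in> U" "e * x = 0" "x * e = x" for x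
  proof -
    have "m * x - x * m = 0"
    proof (rule faithful_f)
      show "m * x - x * m \<in> U"
        by (intro minus_in times_in m x)
      have cE: "(m * x - x * m) * e = m * x - x * m"
        using x m(2) by (simp add: left_diff_distrib mult.assoc) (metis mult.assoc)
      show "(m * x - x * m) * E = m * x - x * m"
        by (rule times_E(1) [OF cE])
      fix y assume y: "y \<in> U"
      define z where "z = e * y * (E - e)"
      have z: "z \<in> U" "e * z = z" "z * e = 0"
        unfolding z_def by (rule off [OF y])+
      have "m * z = z * m"
        by (rule comm [OF z])
      moreover have "m * (x * z) = x * z * m"
        by (rule diag) (use x z in \<open>simp_all add: times_in mult_absorb [OF x(2)] mult.assoc\<close>)
      ultimately have "(m * x - x * m) * z = 0"
        by (simp add: left_diff_distrib mult.assoc)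
      then show "(m * x - x * m) * y * (E - e) = 0"
        using cE unfolding z_def by (metis mult.assoc)
    qed
    then show ?thesis by simp
  qed
  have "m * x = x * m" if x: "x \<in> U" for x
  proof -
    define p where "p = e * x"
    define q where "q = x - p"
    have U: "p \<in> U" "q \<in> U"
      by (auto simp: p_def q_def minus_in times_in e_in x)
    have e: "e * p = p" "e * q = 0"
      by (simp_all add: p_def q_def right_diff_distrib mult_absorb [OF ee])
    note absorb = e [THEN mult_absorb] ee [THEN mult_absorb]
    have "m * (p * e) = p * e * m"
      using U e by (intro corner times_in e_in) (simp_all add: absorb e mult.assoc ee)
    moreover have "m * (p - p * e) = (p - p * e) * m"
      using U e by (intro comm minus_in times_in e_in)
        (simp_all add: right_diff_distrib left_diff_distrib absorb e mult.assoc ee)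
    moreover have "m * (q * e) = q * e * m"
      using U e by (intro lower times_in e_in) (simp_all add: absorb e mult.assoc ee)
    moreover have "m * (q - q * e) = (q - q * e) * m"
      using U e by (intro diag minus_in times_in e_in)
        (simp_all add: right_diff_distrib left_diff_distrib absorb e mult.assoc ee)
    ultimately have "m * (p * e + (p - p * e) + (q * e + (q - q * e)))
        = (p * e + (p - p * e) + (q * e + (q - q * e))) * m"
      by (simp only: distrib_left distrib_right)
    then show ?thesis
      by (simp add: q_def)
  qed
  then show ?thesis
    using m(1) by (simp add: center_def)
qed

end

text \<open>\<open>k\<close> counts the arguments after the first two, so \<open>n = k + 2\<close>.
  \<open>D\<close> is first \<open>G - L\<close> and later \<open>G - L\<close> minus multiplication
  by a central element.\<close>

locale peirce_map = peirce U e E for U :: "'a::{ring,monoid_mult} set" and e E +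
  fixes D :: "'a \<Rightarrow> 'a" and k :: nat
  assumes D_in: "x \<in> U \<Longrightarrow> D x \<in> U"
    and D_plus: "x \<in> U \<Longrightarrow> y \<in> U \<Longrightarrow> D (x + y) = D x + D y"
    and D_first: "x \<in> U \<Longrightarrow> y \<in> U \<Longrightarrow> x * y = e \<Longrightarrow> length Bs = k \<Longrightarrow> set Bs \<subseteq> U \<Longrightarrow>
      D (foldl commutator (commutator x y) Bs) = foldl commutator (commutator (D x) y) Bs"
    and D_second: "x \<in> U \<Longrightarrow> y \<in> U \<Longrightarrow> x * y = e \<Longrightarrow> length Bs = k \<Longrightarrow> set Bs \<subseteq> U \<Longrightarrow>
      D (foldl commutator (commutator x y) Bs) = foldl commutator (commutator x (D y)) Bs"
begin

lemma foldl_commutator_center_times: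
  assumes "c \<in> center U" "x \<in> U" "set Bs \<subseteq> U"
  shows "foldl commutator (c * x) Bs = c * foldl commutator x Bs"
  using assms(2,3)
proof (induction Bs arbitrary: x)
  case (Cons b Bs)
  have "commutator (c * x) b = c * commutator x b"
    using center_commute [OF assms(1), of b] Cons.prems(2)
    by (simp add: commutator_def right_diff_distrib mult.assoc [symmetric])
  then show ?case
    using Cons by (simp add: commutator_in)
qed simp

text \<open>Multiplication by a central element can be pulled out of every commutator and so
  satisfies both identities itself; the correction of \<open>D\<close> by \<open>W\<close> thus
  stays within the locale.\<close>

lemma subtract_center_times:
  assumes W: "W \<in> center U"
  shows "peirce_map U e E (\<lambda>x. D x - W * x) k"
proof (unfold_locales, goal_cases)
  case (1 x)
  then show ?case
    by (intro minus_in times_in D_in center_in [OF W])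
next
  case (2 x y)
  then show ?case
    by (simp add: D_plus distrib_left)
next
  case (3 x y Bs)
  have "commutator (D x - W * x) y = commutator (D x) y - W * commutator x y"
    using center_commute [OF W 3(2)]
    by (simp add: commutator_def left_diff_distrib right_diff_distrib mult.assoc [symmetric])
  then show ?case
    using 3 by (simp add: foldl_commutator_diff foldl_commutator_center_times [OF W] commutator_in D_first)
next
  case (4 x y Bs)
  have "commutator x (D y - W * y) = commutator x (D y) - W * commutator x y"
    using center_commute [OF W 4(1)]
    by (simp add: commutator_def left_diff_distrib right_diff_distrib mult.assoc [symmetric])
  then show ?case
    using 4 by (simp add: foldl_commutator_diff foldl_commutator_center_times [OF W] commutator_in D_second)
qed

section \<open>Consequences of factorizations of \<open>e\<close>\<close>

lemma D_zero: "D 0 = 0"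
  using D_plus [OF zero_in zero_in] by simp

lemma D_minus: "x \<in> U \<Longrightarrow> y \<in> U \<Longrightarrow> D (x - y) = D x - D y"
  using D_plus [of "x - y" y] minus_in by (simp add: eq_diff_eq)

lemma D_uminus: "x \<in> U \<Longrightarrow> D (- x) = - D x"
  using D_minus [OF zero_in] D_zero by simp

text \<open>Both identities have the same left side, so all k-fold commutators of the difference
  vanish.\<close>

lemma D_balance:
  assumes "x \<in> U" "y \<in> U" "x * y = e"
  shows "commutator (D x) y - commutator x (D y) \<in> center U"
proof (rule foldl_commutator_central_imp_central)
  show "commutator (D x) y - commutator x (D y) \<in> U"
    by (intro minus_in commutator_in D_in assms)
  show "foldl commutator (commutator (D x) y - commutator x (D y)) Bs \<in> center U"
    if "length Bs = k" "set Bs \<subseteq> U" for Bs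
    using D_first [OF assms that] D_second [OF assms that]
    by (simp add: foldl_commutator_diff center_zero)
qed

text \<open>For commuting factors the bracket on the left is already zero, so each right side
  vanishes separately.\<close>

lemma D_commuting:
  assumes "x \<in> U" "y \<in> U" "x * y = e" "y * x = e"
  shows "commutator (D x) y \<in> center U" "commutator x (D y) \<in> center U"
proof -
  have zero: "commutator x y = 0"
    using assms(3,4) by (simp add: commutator_def)
  show "commutator (D x) y \<in> center U"
  proof (rule foldl_commutator_central_imp_central)
    show "commutator (D x) y \<in> U"
      by (intro commutator_in D_in assms)
    show "foldl commutator (commutator (D x) y) Bs \<in> center U"
      if "length Bs = k" "set Bs \<subseteq> U" for Bs
      using D_first [OF assms(1-3) that] by (simp add: zero foldl_commutator_zero D_zero center_zero)
  qed
  then show "commutator x (D y) \<in> center U"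
    using center_minus [OF _ D_balance [OF assms(1-3)]] by fastforce
qed

text \<open>The central element \<open>c\<close> is the commutator of \<open>D s\<close> and
  \<open>t\<close>. Comparing \<open>c * e\<close> with \<open>e * c\<close> shows that
  \<open>D s\<close> commutes with \<open>e\<close>; then \<open>c\<close> is supported under
  \<open>e\<close> and must be zero.\<close>

lemma D_unit_pair:
  assumes s: "s \<in> U" "e * s = s" "s * e = s" and t: "t \<in> U" "e * t = t" "t * e = t"
    and st: "s * t = e" "t * s = e"
  shows "commutator (D s) t = 0" "D s * e = e * D s" "D s * s = s * D s"
proof -
  define m where "m = D s"
  define c where "c = m * t - t * m"
  have m: "m \<in> U"
    unfolding m_def by (rule D_in [OF s(1)])
  have c: "c \<in> center U"
    using D_commuting(1) [OF s(1) t(1) st] by (simp add: c_def m_def commutator_def)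
  have "c * e = e * c"
    using c e_in by (rule center_commute)
  then have *: "m * t - t * (m * e) = e * (m * t) - t * m"
    by (simp add: c_def left_diff_distrib right_diff_distrib mult.assoc t mult_absorb [OF t(2)])
  then have "e * (m * t - t * (m * e)) = e * (e * (m * t) - t * m)"
    by simp
  then have tm: "t * (m * e) = t * m"
    by (simp add: right_diff_distrib mult_absorb [OF ee] mult_absorb [OF t(2)])
  then have mt: "m * t = e * (m * t)"
    using * by simp
  have "s * (t * (m * e)) = s * (t * m)"
    by (simp only: tm)
  then have em: "e * (m * e) = e * m"
    by (simp add: mult_absorb [OF st(1)])
  have "m * t * s = e * (m * t) * s"
    using mt by simp
  then have me: "m * e = e * m"
    by (simp add: mult.assoc st em)
  then show "D s * e = e * D s"
    by (simp add: m_def)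
  have "c * e = c"
    by (simp add: c_def left_diff_distrib mult.assoc t tm)
  then have "c = 0"
    using c times_E(1) central_corner_zero by blast
  then have comm: "m * t = t * m"
    by (simp add: c_def)
  then show "commutator (D s) t = 0"
    by (simp add: m_def commutator_def)
  have "s * (m * t) * s = s * (t * m) * s"
    using comm by simp
  then have "s * (m * e) = e * (m * s)"
    by (simp add: mult.assoc st mult_absorb [OF st(1)])
  then have "s * m = m * s"
    using s me by (metis mult.assoc)
  then show "D s * s = s * D s"
    by (simp add: m_def)
qed

lemma D_corner_unit:
  assumes "corner_unit U e s"
  shows "D s * e = e * D s" "D s * s = s * D s"
  using assms D_unit_pair unfolding corner_unit_def by blast+

lemma D_e_commutes_e: "D e * e = e * D e"
  using D_unit_pair(2) [OF e_in ee ee e_in ee ee ee ee] .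

text \<open>Subtracting \<open>D r * r = r * D r\<close> from the same relation for
  \<open>r + e\<close> leaves the cross terms, of which only those with \<open>D e\<close> survive.
  Additivity of \<open>D\<close> suffices, as the increment is \<open>e\<close> itself.\<close>

lemma D_e_commutes_corner:
  assumes a: "a \<in> U" "e * a = a" "a * e = a"
  shows "D e * a = a * D e"
proof -
  have unit: "D e * r = r * D e" if r: "corner_unit U e r" "corner_unit U e (r + e)" for r
  proof -
    have "r \<in> U"
      using r(1) by (simp add: corner_unit_def)
    then have "(D r + D e) * (r + e) = (r + e) * (D r + D e)"
      using D_corner_unit(2) [OF r(2)] D_plus e_in by simp
    then show ?thesis
      using D_corner_unit [OF r(1)] D_e_commutes_e by (simp add: distrib_left distrib_right)
  qed
  obtain r s where "a = r - s" "corner_unit U e r" "corner_unit U e (r + e)"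
    "corner_unit U e s" "corner_unit U e (s + e)"
    using corner_spanned_by_units [OF a] by blast
  then show ?thesis
    using unit by (simp add: left_diff_distrib right_diff_distrib)
qed

text \<open>The factors \<open>e\<close> and \<open>e + b\<close> commute, so the commutator of
  \<open>D e\<close> and \<open>b\<close> is central; it is killed by \<open>e\<close> and hence
  zero.\<close>

lemma D_e_commutes_complement:
  assumes b: "b \<in> U" "e * b = 0" "b * e = 0" "b * E = b"
  shows "D e * b = b * D e"
proof -
  have "commutator (D e) (e + b) \<in> center U"
    using b e_in by (intro D_commuting) (simp_all add: plus_in distrib_left distrib_right ee)
  moreover have "commutator (D e) (e + b) = D e * b - b * D e"
    using D_e_commutes_e by (simp add: commutator_def distrib_left distrib_right)
  ultimately have c: "D e * b - b * D e \<in> center U"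
    by simp
  have DE: "D e * E = E * D e"
    using E_commute [OF D_in [OF e_in]] by simp
  have "D e * b - b * D e = 0"
  proof (rule central_corner_zero [OF c])
    show "(D e * b - b * D e) * E = D e * b - b * D e"
      using b by (simp add: left_diff_distrib mult.assoc DE mult_absorb [OF b(4)])
    show "(D e * b - b * D e) * e = 0 \<or> (D e * b - b * D e) * e = D e * b - b * D e"
      using b by (simp add: left_diff_distrib mult.assoc D_e_commutes_e mult_absorb [OF b(3)])
  qed
  then show ?thesis
    by simp
qed

section \<open>Values of \<open>D\<close> once \<open>D e\<close> is central\<close>

context
  assumes d_center: "D e \<in> center U"
begin

text \<open>In \<open>e = (e + y) * e\<close> the second factor is \<open>e\<close>, so
  \<open>D_second\<close> produces a bracket with the central \<open>D e\<close>. The left side is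
  \<open>D\<close> of \<open>y\<close> up to sign.\<close>

lemma D_upper:
  assumes y: "y \<in> U" "e * y = y" "y * e = 0"
  shows "D y = 0"
proof -
  have comm: "commutator (e + y) e = - y"
    using y by (simp add: commutator_def distrib_left distrib_right)
  \<comment> \<open>Bracketing with \<open>e\<close> reverses the sign of an element of
    \<open>e U (1 - e)\<close>, so the parity of \<open>k\<close> decides between the two
    values.\<close>
  have sign: "foldl commutator z (replicate k e) \<in> {z, - z}" if "e * z = z" "z * e = 0" for z k
    using that
  proof (induction k arbitrary: z)
    case (Suc k)
    then have "commutator z e = - z"
      by (simp add: commutator_def)
    then show ?case
      using Suc.IH [of "- z"] Suc.prems by auto
  qed simp
  have fold: "foldl commutator (- y) (replicate k e) \<in> {- y, y}"
    using sign [of "- y" k] y by simp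
  have "D (foldl commutator (commutator (e + y) e) (replicate k e))
      = foldl commutator (commutator (e + y) (D e)) (replicate k e)"
    using y e_in by (intro D_second) (auto simp: plus_in distrib_right ee)
  also have "commutator (e + y) (D e) = 0"
    by (rule commutator_center_right [OF d_center plus_in [OF e_in y(1)]])
  finally have "D (foldl commutator (- y) (replicate k e)) = 0"
    by (simp add: comm foldl_commutator_zero)
  then show ?thesis
    using fold D_uminus [OF y(1)] by auto
qed

text \<open>The mirror image, from \<open>e = e * (e + x)\<close> and \<open>D_first\<close>; here
  bracketing with \<open>e\<close> fixes the element.\<close>

lemma D_lower:
  assumes x: "x \<in> U" "e * x = 0" "x * e = x"
  shows "D x = 0"
proof -
  have comm: "commutator e (e + x) = - x"
    using x by (simp add: commutator_def distrib_left distrib_right)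
  have fold: "foldl commutator z (replicate k e) = z" if "e * z = 0" "z * e = z" for z k
    using that by (induction k) (simp_all add: commutator_def)
  have "D (foldl commutator (commutator e (e + x)) (replicate k e))
      = foldl commutator (commutator (D e) (e + x)) (replicate k e)"
    using x e_in by (intro D_first) (auto simp: plus_in distrib_left ee)
  also have "commutator (D e) (e + x) = 0"
    by (rule commutator_center_left [OF d_center plus_in [OF e_in x(1)]])
  finally have "D (- x) = 0"
    using fold [of "- x"] x by (simp add: comm foldl_commutator_zero)
  then show ?thesis
    using D_uminus [OF x(1)] by simp
qed

text \<open>The commutator stays in \<open>e U (1 - e)\<close>, which contains no nonzero central
  element.\<close>

lemma commutator_upper_zero:
  assumes y: "y \<in> U" "e * y = y" "y * e = 0" and m: "m * e = e * m"
    and c: "commutator y m \<in> center U"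
  shows "m * y = y * m"
proof -
  have "e * commutator y m = commutator y m"
    using y m by (simp add: commutator_def right_diff_distrib mult_absorb [OF y(2)])
      (metis mult.assoc)
  moreover have "commutator y m * e = 0"
    using y m by (simp add: commutator_def left_diff_distrib mult.assoc mult_absorb [OF y(3)])
  ultimately have "commutator y m = 0"
    using central_off_diagonal_zero [OF c] by blast
  then show ?thesis
    by (simp add: commutator_def)
qed

text \<open>Adding \<open>y\<close> to the inverse \<open>s\<close> changes neither the product with
  \<open>t\<close> nor the value of \<open>D\<close>. Balancing \<open>e = (s + y) * t\<close>
  therefore isolates the commutator of \<open>y\<close> and \<open>D t\<close>.\<close>

lemma D_corner_unit_central:
  assumes "corner_unit U e t"
  shows "D t \<in> center U"
proof -
  obtain s where t: "t \<in> U" "e * t = t" "t * e = t" and s: "s \<in> U" "e * s = s" "s * e = s"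
    and ts: "t * s = e" "s * t = e"
    using assms unfolding corner_unit_def by blast
  show ?thesis
  proof (rule commutes_off_diagonal_imp_central)
    show "D t \<in> U"
      by (rule D_in [OF t(1)])
    show Dte: "D t * e = e * D t"
      by (rule D_corner_unit(1) [OF assms])
    fix y assume y: "y \<in> U" "e * y = y" "y * e = 0"
    have "y * t = 0"
      using y(3) t(2) by (metis mult.assoc mult_zero_left)
    then have "(s + y) * t = e"
      using ts by (simp add: distrib_right)
    then have "commutator (D (s + y)) t - commutator (s + y) (D t) \<in> center U"
      by (intro D_balance plus_in s y t)
    moreover have "commutator (D (s + y)) t = 0"
      using D_plus [OF s(1) y(1)] D_upper [OF y] D_unit_pair(1) [OF s t ts(2,1)] by simp
    moreover have "commutator s (D t) = 0"
      using D_unit_pair(1) [OF t s ts] by (simp add: commutator_def)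
    ultimately have "0 - commutator y (D t) \<in> center U"
      by (simp add: commutator_simps)
    then have "commutator y (D t) \<in> center U"
      using center_minus [OF center_zero] by fastforce
    then show "D t * y = y * D t"
      using commutator_upper_zero [OF y Dte] by blast
  qed
qed

lemma D_corner_central:
  assumes a: "a \<in> U" "e * a = a" "a * e = a"
  shows "D a \<in> center U"
proof -
  obtain r s where rs: "a = r - s" "corner_unit U e r" "corner_unit U e s"
    using corner_spanned_by_units [OF a] by blast
  then have "r \<in> U" "s \<in> U"
    by (auto simp: corner_unit_def)
  then show ?thesis
    using center_minus D_corner_unit_central rs by (simp add: D_minus)
qed

text \<open>Here the factorization \<open>e = (e + y) (e - y b + b)\<close> is used.\<close>

lemma D_complement_central:
  assumes b: "b \<in> U" "e * b = 0" "b * e = 0"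
  shows "D b \<in> center U"
proof (rule commutes_off_diagonal_imp_central)
  show "D b \<in> U"
    by (rule D_in [OF b(1)])
  have Deb: "D (e + b) = D e + D b"
    by (rule D_plus [OF e_in b(1)])
  have de: "commutator x (D e) = 0" if "x \<in> U" for x
    by (rule commutator_center_right [OF d_center that])
  have "commutator e (D (e + b)) \<in> center U"
    using b e_in by (intro D_commuting(2)) (simp_all add: plus_in distrib_left distrib_right ee)
  then have "0 - commutator e (D b) \<in> center U"
    using center_minus [OF center_zero] by (simp add: Deb commutator_simps de e_in)
  then have "commutator (D b) e \<in> center U"
    by (simp add: commutator_def)
  then show Dbe: "D b * e = e * D b"
    by (rule central_commutator_e [OF D_in [OF b(1)]])
  fix y assume y: "y \<in> U" "e * y = y" "y * e = 0"
  have yy: "y * y = 0"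
    using y(2,3) by (metis mult.assoc mult_zero_left)
  have yb: "y * b \<in> U" "e * (y * b) = y * b" "y * b * e = 0"
    using y b by (simp_all add: times_in mult_absorb [OF y(2)] mult.assoc)
  define w where "w = e - y * b + b"
  have wU: "w \<in> U"
    unfolding w_def by (intro plus_in minus_in e_in yb b)
  have prod: "(e + y) * w = e"
    unfolding w_def using y b yb yy
    by (simp add: distrib_left distrib_right right_diff_distrib ee mult_absorb [OF yy])
  \<comment> \<open>\<open>D\<close> vanishes on \<open>y\<close> and on \<open>y * b\<close>, so
    balancing retains \<open>y\<close> only in its commutator with \<open>D b\<close>.\<close>
  have Dw: "D w = D e + D b"
    unfolding w_def using yb b e_in by (simp add: D_plus D_minus minus_in D_upper [OF yb])
  have Dy: "D (e + y) = D e"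
    using D_plus [OF e_in y(1)] D_upper [OF y] by simp
  have "commutator (D (e + y)) w - commutator (e + y) (D w) \<in> center U"
    by (rule D_balance [OF plus_in [OF e_in y(1)] wU prod])
  moreover have "commutator (D (e + y)) w = 0"
    unfolding Dy by (rule commutator_center_left [OF d_center wU])
  moreover have "commutator e (D b) = 0"
    using Dbe by (simp add: commutator_def)
  ultimately have "0 - commutator y (D b) \<in> center U"
    unfolding Dw by (simp add: commutator_simps de e_in y)
  then have "commutator y (D b) \<in> center U"
    using center_minus [OF center_zero] by fastforce
  then show "D b * y = y * D b"
    by (rule commutator_upper_zero [OF y Dbe])
qed

lemma D_central:
  assumes x: "x \<in> U"
  shows "D x \<in> center U"
proof -
  define p where "p = e * x"
  define q where "q = x - p"
  have U: "p \<in> U" "q \<in> U" "p * e \<in> U" "q * e \<in> U"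
    by (auto simp: p_def q_def minus_in times_in e_in x)
  have e: "e * p = p" "e * q = 0"
    by (simp_all add: p_def q_def right_diff_distrib mult_absorb [OF ee])
  note absorb = e [THEN mult_absorb] ee [THEN mult_absorb]
  have "D (p * e) \<in> center U"
    by (rule D_corner_central) (simp_all add: U absorb e mult.assoc ee)
  moreover have "D (p - p * e) = 0"
    by (rule D_upper) (simp_all add: U minus_in right_diff_distrib left_diff_distrib absorb e mult.assoc ee)
  moreover have "D (q * e) = 0"
    by (rule D_lower) (simp_all add: U absorb e mult.assoc ee)
  moreover have "D (q - q * e) \<in> center U"
    by (rule D_complement_central)
      (simp_all add: U minus_in right_diff_distrib left_diff_distrib absorb e mult.assoc ee)
  moreover have "D x = D (p * e) + D (p - p * e) + (D (q * e) + D (q - q * e))"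
    using U by (simp add: D_plus [symmetric] plus_in minus_in) (simp add: q_def)
  ultimately show ?thesis
    by (simp add: center_plus)
qed

end

end

section \<open>Iterated commutators\<close>

text \<open>With \<open>n = k + 2\<close> the list runs over the arguments 3 to n and is empty for
  \<open>n = 2\<close>.\<close>

lemma pn_foldl:
  "pn (Suc (Suc k)) A = foldl commutator (commutator (A 1) (A 2)) (map A [3..<k + 3])"
  by (induction k) (simp_all add: numeral_2_eq_2 numeral_3_eq_3)

lemma pn_cong: "(\<And>j. j \<in> {1..n} \<Longrightarrow> A j = B j) \<Longrightarrow> pn n A = pn n B"
  by (induction n A rule: pn.induct) auto

lemma pn_upd_above: "n < i \<Longrightarrow> pn n (A(i := x)) = pn n A"
  by (rule pn_cong) simp

lemma pn_upd_plus:
  "i \<in> {1..n} \<Longrightarrow> pn n (A(i := x + y)) = pn n (A(i := x)) + pn n (A(i := y))"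
proof (induction n A rule: pn.induct)
  case (3 k A)
  show ?case
  proof (cases "i = Suc (Suc k)")
    case True
    then show ?thesis
      by (simp add: pn_upd_above commutator_simps fun_upd_same del: fun_upd_apply)
  next
    case False
    then show ?thesis
      using 3 by (simp add: commutator_simps)
  qed
qed auto

context peirce
begin

lemma pn_in: "(\<And>j. j \<in> {1..n} \<Longrightarrow> A j \<in> U) \<Longrightarrow> pn n A \<in> U"
  by (induction n A rule: pn.induct) (auto simp: zero_in commutator_in)

lemma pn_upd_center:
  assumes "2 \<le> n" "i \<in> {1..n}" "c \<in> center U" "\<And>j. j \<in> {1..n} \<Longrightarrow> A j \<in> U"
  shows "pn n (A(i := c)) = 0"
  using assms
proof (induction n A rule: pn.induct)
  case (3 k A)
  \<comment> \<open>The middle case is separate because the shorter bracket is then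
    \<open>pn 1\<close>, the central entry itself, which is not zero in general.\<close>
  consider "i = Suc (Suc k)" | "i = 1" "k = 0" | "i \<le> Suc k" "k \<ge> 1"
    using 3(3) by fastforce
  then show ?case
  proof cases
    case 1
    show ?thesis
    proof -
      have "pn (Suc k) A \<in> U"
        using 3(5) by (intro pn_in) auto
      then show ?thesis
        using 1 by (simp add: pn_upd_above fun_upd_same commutator_center_right [OF 3(4)] del: fun_upd_apply)
    qed
  next
    case 2
    then show ?thesis
      using 3(5) by (simp add: commutator_center_left [OF 3(4)])
  next
    case 3
    then show ?thesis
      using "3.IH" "3.prems" by (simp add: commutator_simps)
  qed
qed auto

end

section \<open>The Peirce decomposition of a von Neumann algebra\<close>

context vn_algebra
begin

text \<open>\<open>a + r\<close> commutes with \<open>e\<close>, hence so does its inverse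
  \<open>T\<close> in \<open>U\<close>, and \<open>T * e\<close> is the inverse in the
  corner.\<close>

lemma corner_unit_large_scalar:
  assumes e: "e \<in> U" "e * e = e" and a: "a \<in> U" "e * a = a" "a * e = a"
  shows "\<exists>b. \<forall>r>b. corner_unit U e (a + complex_of_real r *\<^sub>C e)"
proof -
  obtain b where b: "\<And>r. r > b \<Longrightarrow> \<exists>T\<in>U. (complex_of_real r *\<^sub>C 1 + a) * T = 1
      \<and> T * (complex_of_real r *\<^sub>C 1 + a) = 1"
    using eventually_invertible [OF a(1)] by blast
  have "corner_unit U e (a + complex_of_real r *\<^sub>C e)" if r: "r > b" for r
  proof -
    define X where "X = complex_of_real r *\<^sub>C 1 + a"
    define s where "s = a + complex_of_real r *\<^sub>C e"
    obtain T where T: "T \<in> U" "X * T = 1" "T * X = 1"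
      using b [OF r] unfolding X_def by blast
    have scal: "(complex_of_real r *\<^sub>C 1) * e = complex_of_real r *\<^sub>C e"
      "e * (complex_of_real r *\<^sub>C 1) = complex_of_real r *\<^sub>C e"
      using scaleC_times_scaleC [of "complex_of_real r" 1 1 e]
        scaleC_times_scaleC [of 1 e "complex_of_real r" 1] by (simp_all add: scaleC_one_bop)
    have Xe: "X * e = s" "e * X = s"
      by (simp_all add: X_def s_def distrib_left distrib_right scal a add.commute)
    have "T * (e * X) * T = T * (X * e) * T"
      by (simp add: Xe)
    then have Te: "T * e = e * T"
      by (simp add: mult.assoc T(2)) (simp add: mult.assoc [symmetric] T(3))
    have "s \<in> U"
      unfolding s_def by (intro plus_in scaleC_in a e)
    moreover have "e * s = s" "s * e = s"
      using Xe e(2) by (metis mult.assoc)+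
    moreover have "T * e \<in> U" "e * (T * e) = T * e" "T * e * e = T * e"
      using T(1) e by (simp_all add: times_in Te mult_absorb [OF e(2)]) (simp add: Te [symmetric] mult.assoc e(2))
    moreover have "s * (T * e) = e"
      unfolding Xe(2) [symmetric] by (simp add: mult.assoc mult_absorb [OF T(2)] e(2))
    moreover have "T * e * s = e"
      unfolding Xe(1) [symmetric] Te by (simp add: mult.assoc mult_absorb [OF T(3)] e(2))
    ultimately show ?thesis
      unfolding corner_unit_def s_def by blast
  qed
  then show ?thesis
    by blast
qed

lemma peirce_projection:
  assumes E: "is_central_carrier U P E" and P: "P \<in> U" "is_projection P" "core_free U P"
    and abelian: "type_I1 (summand U (1 - E))"
  shows "peirce U P E"
proof -
  have Ec: "E \<in> center U" and Ep: "is_projection E" and EP: "E * P = P"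
    using E by (auto simp: is_central_carrier_def)
  have EU: "E \<in> U" and E_comm: "\<And>x. x \<in> U \<Longrightarrow> E * x = x * E"
    using Ec center_in center_commute by auto
  have PP: "P * P = P" and EE: "E * E = E"
    using P Ep is_projectionD(2) by auto
  show ?thesis
  proof (unfold_locales, goal_cases)
    case (10 x)
    define F where "F = 1 - E"
    have FU: "F \<in> U"
      unfolding F_def by (intro minus_in one_in EU)
    have F_comm: "y * F = F * y" if "y \<in> U" for y
      using E_comm [OF that] by (simp add: F_def algebra_simps)
    have FF: "F * F = F"
      by (simp add: F_def algebra_simps EE)
    have "F * x * y = y * (F * x)" if y: "y \<in> U" for y
    proof -
      have "x * F * (y * F) = y * F * (x * F)"
        using abelian 10 y unfolding type_I1_def summand_def F_def by blast
      then show ?thesis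
        by (simp add: mult.assoc F_comm [OF 10] F_comm [OF y] mult_absorb [OF F_comm [OF 10]]
            mult_absorb [OF F_comm [OF y]] mult_absorb [OF FF] FF)
    qed
    then show ?case
      using 10 FU by (simp add: F_def center_def times_in)
  next
    case (11 c)
    then show ?case
      by (rule central_square_zero)
  next
    case (12 x)
    then show ?case
      using carrier_faithful [OF E P(1)] by blast
  next
    case (13 x)
    then show ?case
      using core_free_faithful [OF E P] by blast
  next
    case (14 x)
    show ?case
      by (rule faithful_left [OF carrier_faithful [OF E P(1)] P(2) Ep Ec 14])
  next
    case (15 a)
    obtain b where b: "\<And>r. r > b \<Longrightarrow> corner_unit U P (a + complex_of_real r *\<^sub>C P)"
      using corner_unit_large_scalar [OF P(1) PP 15] by blast
    obtain c where c: "\<And>r. r > c \<Longrightarrow> corner_unit U P (0 + complex_of_real r *\<^sub>C P)"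
      using corner_unit_large_scalar [OF P(1) PP zero_in] by auto
    \<comment> \<open>Here \<open>a\<close> is written as the difference of \<open>a + r P\<close>
      and \<open>r P\<close>. Both \<open>r\<close> and \<open>r + 1\<close> must exceed the
      thresholds for \<open>a\<close> and for 0, so that the two elements and their translates by
      \<open>P\<close> are units.\<close>
    define r where "r = max b c + 1"
    have r: "r > b" "r + 1 > b" "r > c" "r + 1 > c"
      by (auto simp: r_def)
    have r1: "complex_of_real (r + 1) *\<^sub>C P = complex_of_real r *\<^sub>C P + P"
    proof (rule bop_eqI)
      show "(complex_of_real (r + 1) *\<^sub>C P) \<star> x = (complex_of_real r *\<^sub>C P + P) \<star> x" for x
        by (simp only: bop_apply_scaleC bop_apply_plus scaleC_of_real scaleR_add_left scaleR_one)
    qed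
    show ?case
      using b [OF r(1)] b [OF r(2)] c [OF r(3)] c [OF r(4)] unfolding r1
      by (intro exI [of _ "a + complex_of_real r *\<^sub>C P"] exI [of _ "complex_of_real r *\<^sub>C P"])
        (simp add: add.assoc)
  qed (auto simp: one_in plus_in minus_in times_in P PP Ec EE EP)
qed

end

section \<open>The central multiplier \<open>W\<close> and the map \<open>chi\<close>\<close>

theorem theorem3p3:
  fixes n :: nat
    and U :: "'a::chilbert_space bop set"
    and E1 E2 P :: "'a bop"
    and L G :: "'a bop \<Rightarrow> 'a bop"
  assumes "n \<ge> 2"
    and "von_neumann_algebra U"
    and "E1 \<in> center U" and "is_projection E1"
    and "E2 \<in> center U" and "is_projection E2"
    and "E1 * E2 = 0" and "E1 + E2 = 1"
    and "type_I1 (summand U E1)"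
    and "no_central_summand_I1 (summand U E2)"
    and "P \<in> summand U E2" and "is_projection P"
    and "core_free U P"
    and "is_central_carrier U P E2"
    and "additive_map_on U L" and "additive_map_on U G"
    and "\<And>A. (\<forall>i\<in>{1..n}. A i \<in> U) \<Longrightarrow> A 1 * A 2 = P \<Longrightarrow>
           L (pn n A) = (\<Sum>i=1..n. pn n (A(i := L (A i))))"
    and "\<And>A. (\<forall>i\<in>{1..n}. A i \<in> U) \<Longrightarrow> A 1 * A 2 = P \<Longrightarrow>
           G (pn n A) = pn n (A(1 := G (A 1))) + (\<Sum>i=2..n. pn n (A(i := L (A i))))"
    and "\<And>A. (\<forall>i\<in>{1..n}. A i \<in> U) \<Longrightarrow> A 1 * A 2 = P \<Longrightarrow>
           G (pn n A) = pn n (A(1 := L (A 1))) + pn n (A(2 := G (A 2)))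
             + (\<Sum>i=3..n. pn n (A(i := L (A i))))"
  shows "\<exists>W\<in>center U. \<exists>chi. additive_map_on U chi \<and>
           (\<forall>A\<in>U. G A = W * A + chi A) \<and>
           (\<forall>A. (\<forall>i\<in>{1..n}. A i \<in> U) \<longrightarrow> A 1 * A 2 = P \<longrightarrow>
              chi (pn n A) = (\<Sum>i=1..n. pn n (A(i := chi (A i)))))"
proof -
  interpret vn_algebra U
    by unfold_locales fact
  have PU: "P \<in> U"
    using assms(5,11) times_in center_in by (auto simp: summand_def)
  have "E1 = 1 - E2"
    using \<open>E1 + E2 = 1\<close> by (simp add: eq_diff_eq)
  then have abelian: "type_I1 (summand U (1 - E2))"
    using assms(9) by simp
  interpret peirce U P E2
    by (rule peirce_projection [OF assms(14) PU assms(12,13) abelian])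
  obtain k where n: "n = Suc (Suc k)"
    using \<open>n \<ge> 2\<close> by (metis add_2_eq_Suc le_Suc_ex)
  have L: "\<And>x. x \<in> U \<Longrightarrow> L x \<in> U" "\<And>x y. x \<in> U \<Longrightarrow> y \<in> U \<Longrightarrow> L (x + y) = L x + L y"
    and G: "\<And>x. x \<in> U \<Longrightarrow> G x \<in> U" "\<And>x y. x \<in> U \<Longrightarrow> y \<in> U \<Longrightarrow> G (x + y) = G x + G y"
    using assms(15,16) by (auto simp: additive_map_on_def)
  define D where "D = (\<lambda>x. G x - L x)"
  \<comment> \<open>The sequence with entries \<open>x\<close>, \<open>y\<close> and then
    \<open>Bs\<close>: position 3 is \<open>Bs ! 0\<close>, and \<open>pn n\<close> reads the
    positions 1 to n only.\<close>
  define arg where "arg = (\<lambda>x y (Bs :: 'a bop list) i. if i = 1 then x else if i = 2 then y else Bs ! (i - 3))"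
  have pn_arg: "pn n (arg x y Bs) = foldl commutator (commutator x y) Bs" if "length Bs = k" for x y Bs
  proof -
    have "map (arg x y Bs) [3..<k + 3] = Bs"
      using that by (intro nth_equalityI) (auto simp: arg_def)
    then show ?thesis
      unfolding n pn_foldl by (simp add: arg_def)
  qed
  have arg_in: "\<forall>i\<in>{1..n}. arg x y Bs i \<in> U"
    if "x \<in> U" "y \<in> U" "length Bs = k" "set Bs \<subseteq> U" for x y Bs
  proof
    fix i assume i: "i \<in> {1..n}"
    show "arg x y Bs i \<in> U"
    proof (cases "i = 1 \<or> i = 2")
      case False
      then have "i - 3 < length Bs"
        using i that(3) n by auto
      then show ?thesis
        using False that(4) nth_mem by (auto simp: arg_def)
    qed (use that in \<open>auto simp: arg_def\<close>)
  qed
  have arg_upd: "(arg x y Bs)(1 := z) = arg z y Bs" "(arg x y Bs)(2 := z) = arg x z Bs" for x y z Bs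
    by (auto simp: arg_def fun_eq_iff)
  have arg_at: "arg x y Bs 1 = x" "arg x y Bs 2 = y" for x y Bs
    by (auto simp: arg_def)
  have split1: "(\<Sum>i=1..n. f i) = f 1 + (\<Sum>i=2..n. f i)" for f :: "nat \<Rightarrow> 'a bop"
    by (simp add: n sum.atLeast_Suc_atMost numeral_2_eq_2)
  have split2: "(\<Sum>i=2..n. f i) = f 2 + (\<Sum>i=3..n. f i)" for f :: "nat \<Rightarrow> 'a bop"
    using sum.atLeast_Suc_atMost [of 2 n f] \<open>n \<ge> 2\<close> by simp
  interpret D: peirce_map U P E2 D k
  proof (unfold_locales, goal_cases)
    case (1 x)
    then show ?case
      by (simp add: D_def L G minus_in)
  next
    case (2 x y)
    then show ?case
      by (simp add: D_def L G)
  next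
    case (3 x y Bs)
    have A: "\<forall>i\<in>{1..n}. arg x y Bs i \<in> U" "arg x y Bs 1 * arg x y Bs 2 = P"
      using arg_in 3 by (auto simp: arg_def)
    \<comment> \<open>The terms with \<open>L\<close> at position 2 or later occur in both
      expansions and cancel.\<close>
    have "D (pn n (arg x y Bs)) = pn n (arg (G x) y Bs) - pn n (arg (L x) y Bs)"
      unfolding D_def assms(17) [OF A] assms(18) [OF A] split1 arg_upd arg_at
      by simp
    then show ?case
      using 3(4) by (simp add: pn_arg D_def commutator_simps foldl_commutator_diff)
  next
    case (4 x y Bs)
    have A: "\<forall>i\<in>{1..n}. arg x y Bs i \<in> U" "arg x y Bs 1 * arg x y Bs 2 = P"
      using arg_in 4 by (auto simp: arg_def)
    \<comment> \<open>Here the term at position 1 and those from position 3 on cancel.\<close>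
    have "D (pn n (arg x y Bs)) = pn n (arg x (G y) Bs) - pn n (arg x (L y) Bs)"
      unfolding D_def assms(17) [OF A] assms(19) [OF A] split1 split2 arg_upd arg_at
      by simp
    then show ?case
      using 4(4) by (simp add: pn_arg D_def commutator_simps foldl_commutator_diff)
  qed
  define d where "d = D P"
  have dU: "d \<in> U" and dP: "d * P = P * d"
    unfolding d_def using D.D_in [OF PU] D.D_e_commutes_e by auto
  have P_proj: "is_projection P" and E2_proj: "is_projection E2"
    by fact+
  have f_proj: "is_projection (E2 - P)"
    by (intro is_projection_minus E2_proj P_proj Ee eE)
  have fU: "E2 - P \<in> U"
    by (rule minus_in [OF E_in PU])
  have ff: "(E2 - P) * (E2 - P) = E2 - P" and Ef: "E2 * (E2 - P) = E2 - P"
    and df: "d * (E2 - P) = (E2 - P) * d" and Pf: "P * (E2 - P) = 0" "(E2 - P) * P = 0"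
    using is_projectionD(2) [OF f_proj] dP E_commute [OF dU]
    by (simp_all add: right_diff_distrib left_diff_distrib EE Ee ee eE)
  have corner: "d * p \<in> corner_center p"
    if p: "p \<in> U" "p * p = p" "d * p = p * d" and comm: "\<And>A. A \<in> U \<Longrightarrow> d * (p * A * p) = p * A * p * d" for p
  proof -
    have "d * p * (p * A * p) = p * A * p * (d * p)" if "A \<in> U" for A
      using comm [OF that] p(2,3) by (metis mult.assoc)
    moreover have "p * (d * p) = d * p" "d * p * p = d * p"
      using p(2,3) by (metis mult.assoc)+
    ultimately show ?thesis
      using times_in [OF dU p(1)] by (simp add: corner_center_def)
  qed
  have "d * P \<in> corner_center P"
    using D.D_e_commutes_corner ee PU dP
    by (intro corner) (auto simp: d_def times_in mult.assoc mult_absorb [OF ee])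
  then obtain z' where z': "z' \<in> center U" "z' * P = d * P"
    using corner_center_extends [OF assms(5) E2_proj P_proj PU Ee faithful_e] by blast
  have "d * (E2 - P) \<in> corner_center (E2 - P)"
  proof (rule corner [OF fU ff df])
    fix A assume "A \<in> U"
    then show "d * ((E2 - P) * A * (E2 - P)) = (E2 - P) * A * (E2 - P) * d"
      unfolding d_def
    proof (intro D.D_e_commutes_complement)
      have fE: "(E2 - P) * E2 = E2 - P"
        using Ef E_commute [OF fU] by simp
      show "P * ((E2 - P) * A * (E2 - P)) = 0" "(E2 - P) * A * (E2 - P) * P = 0"
        "(E2 - P) * A * (E2 - P) * E2 = (E2 - P) * A * (E2 - P)"
        by (simp_all only: mult.assoc mult_absorb [OF Pf(1)] Pf(2) fE mult_zero_left mult_zero_right)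
    qed (intro times_in fU)
  qed
  then obtain z where z: "z \<in> center U" "z * (E2 - P) = d * (E2 - P)"
    using corner_center_extends [OF assms(5) E2_proj f_proj fU Ef faithful_f] by blast
  define W where "W = z' - z"
  have W: "W \<in> center U"
    unfolding W_def by (rule center_minus [OF z'(1) z(1)])
  interpret D': peirce_map U P E2 "\<lambda>x. D x - W * x" k
    by (rule D.subtract_center_times [OF W])
  \<comment> \<open>On \<open>P\<close> the element \<open>d\<close> acts as \<open>z'\<close> and
    on \<open>E2 - P\<close> as \<open>z\<close>. Subtracting \<open>(z' - z) * P\<close> leaves
    \<open>z\<close> on both pieces, and the part under \<open>1 - E2\<close> is central in any
    case.\<close>
  have "D P - W * P = z * E2 + (1 - E2) * d"
  proof -
    have "d * E2 = d * P + z * (E2 - P)"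
      unfolding z(2) by (simp add: right_diff_distrib)
    then show ?thesis
      using E_commute [OF dU] z'(2)
      by (simp add: W_def d_def left_diff_distrib right_diff_distrib)
  qed
  then have "D P - W * P \<in> center U"
    using center_plus [OF center_times [OF z(1) E_center] complement_central [OF dU]] by simp
  note central = D'.D_central [OF this]
  define chi where "chi = (\<lambda>x. G x - W * x)"
  have chi: "chi x = L x + (D x - W * x)" for x
    by (simp add: chi_def D_def)
  have "chi (pn n A) = (\<Sum>i=1..n. pn n (A(i := chi (A i))))"
    if A: "\<forall>i\<in>{1..n}. A i \<in> U" "A 1 * A 2 = P" for A
  proof -
    have A12: "A 1 \<in> U" "A 2 \<in> U"
      using A(1) n by auto
    have Bs: "length (map A [3..<k + 3]) = k" "set (map A [3..<k + 3]) \<subseteq> U"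
      using A(1) n by auto
    have "commutator (D (A 1) - W * A 1) (A 2) = 0"
      by (rule commutator_center_left [OF central [OF A12(1)] A12(2)])
    \<comment> \<open>The corrected map has a central value at \<open>A 1\<close>, so its
      \<open>D_first\<close> identity makes it vanish on the whole bracket; \<open>chi\<close> and
      \<open>L\<close> agree there.\<close>
    then have "D (pn n A) - W * pn n A = 0"
      using D'.D_first [OF A12 A(2) Bs] unfolding n pn_foldl by (simp add: foldl_commutator_zero)
    then have "chi (pn n A) = L (pn n A)"
      by (simp add: chi)
    also have "\<dots> = (\<Sum>i=1..n. pn n (A(i := L (A i))))"
      by (rule assms(17) [OF A])
    also have "\<dots> = (\<Sum>i=1..n. pn n (A(i := chi (A i))))"
    proof (rule sum.cong [OF refl])
      fix i assume i: "i \<in> {1..n}"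
      then have "D (A i) - W * A i \<in> center U"
        using A(1) by (intro central) auto
      \<comment> \<open>\<open>L\<close> and \<open>chi\<close> differ at each entry by a central
        element, which contributes nothing to a bracket of at least two arguments.\<close>
      then have "pn n (A(i := D (A i) - W * A i)) = 0"
        using A(1) by (intro pn_upd_center [OF \<open>n \<ge> 2\<close> i]) auto
      then show "pn n (A(i := L (A i))) = pn n (A(i := chi (A i)))"
        unfolding chi by (simp only: pn_upd_plus [OF i] add_0_right)
    qed
    finally show ?thesis .
  qed
  moreover have "additive_map_on U chi"
    using center_in [OF W]
    by (simp add: additive_map_on_def chi_def G minus_in times_in distrib_left)
  moreover have "\<forall>A\<in>U. G A = W * A + chi A"
    by (simp add: chi_def)
  ultimately show ?thesis
    using W by blast
qed

end
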